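(* Let $\{Y_i\mid i\in I\}$ be a family of Esakia root systems. Then $\bigotimes_iY_i$, together with the maps $p_i\colon\bigotimes_iY_i\to Y_i$ defined by $p_i(C)=\pi_i(m(C))$ (where $m(C)$ is the least element of $C$), is the product of $\{Y_i\mid i\in I\}$ in the category of Esakia root systems and continuous p-morphisms.
   Context: An Esakia root system is a Priestley space (compact, with a partial order such that $x\not\le y$ gives a clopen upset containing $x$ but not $y$) in which ${\downarrow}V$ is clopen for every clopen $V$ and ${\uparrow}y$ is a chain for every $y$. A p-morphism is a map $g$ with $g[{\uparrow}y]={\uparrow}g(y)$. $\prod_iY_i$ has the product topology and componentwise order; $\pi_i$ are the projections. For a Priestley space $X$, $\mathsf{CC}(X)$ is the set of nonempty closed chains of $X$, with topology generated by $\Box V=\{C\mid C\subseteq V\}$, $\Diamond V=\{C\mid C\cap V\ne\varnothing\}$ ($V$ clopen) and order $C_1\unlhd C_2$ iff $C_2\subseteq C_1$ and $C_2$ is an upset of $C_1$. $\bigotimes_iY_i=\{C\in\mathsf{CC}(\prod_iY_i)\mid\pi_i[C]\text{ is an upset of }Y_i\text{ for every }i\}$ with the induced topology and order. *)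

theory Defs
  imports "HOL-Analysis.Analysis"
begin

text \<open>
  An ordered space is given by a topology \<open>X\<close>, with carrier \<open>topspace X\<close>, and a relation \<open>r\<close>
  on the carrier; \<open>(x, y) \<in> r\<close> means \<open>x \<le> y\<close>. Hence \<open>r `` {x}\<close> is the principal upset of
  \<open>x\<close>, and \<open>r\<inverse> `` V\<close> is the downset generated by \<open>V\<close>.
\<close>

definition clopenin :: "'a topology \<Rightarrow> 'a set \<Rightarrow> bool" where
  "clopenin X V \<longleftrightarrow> openin X V \<and> closedin X V"

definition upset_of :: "'a rel \<Rightarrow> 'a set \<Rightarrow> 'a set \<Rightarrow> bool" where
  "upset_of r A U \<longleftrightarrow> U \<subseteq> A \<and> (\<forall>x\<in>U. \<forall>y\<in>A. (x, y) \<in> r \<longrightarrow> y \<in> U)"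

definition priestley_space :: "'a topology \<Rightarrow> 'a rel \<Rightarrow> bool" where
  "priestley_space X r \<longleftrightarrow>
     compact_space X \<and> partial_order_on (topspace X) r \<and>
     (\<forall>x\<in>topspace X. \<forall>y\<in>topspace X. (x, y) \<notin> r \<longrightarrow>
        (\<exists>U. clopenin X U \<and> upset_of r (topspace X) U \<and> x \<in> U \<and> y \<notin> U))"

definition esakia_root_system :: "'a topology \<Rightarrow> 'a rel \<Rightarrow> bool" where
  "esakia_root_system X r \<longleftrightarrow>
     priestley_space X r \<and>
     (\<forall>V. clopenin X V \<longrightarrow> clopenin X (r\<inverse> `` V)) \<and>
     (\<forall>y\<in>topspace X. r `` {y} \<in> Chains r)"

definition continuous_p_morphism ::
  "'a topology \<Rightarrow> 'a rel \<Rightarrow> 'b topology \<Rightarrow> 'b rel \<Rightarrow> ('a \<Rightarrow> 'b) \<Rightarrow> bool" where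
  "continuous_p_morphism X r Y s g \<longleftrightarrow>
     continuous_map X Y g \<and> (\<forall>x\<in>topspace X. g ` (r `` {x}) = s `` {g x})"

definition product_order ::
  "('i \<Rightarrow> 'a topology) \<Rightarrow> ('i \<Rightarrow> 'a rel) \<Rightarrow> 'i set \<Rightarrow> ('i \<Rightarrow> 'a) rel" where
  "product_order Y r I =
     {(x, y). x \<in> topspace (product_topology Y I) \<and> y \<in> topspace (product_topology Y I) \<and>
              (\<forall>i\<in>I. (x i, y i) \<in> r i)}"

definition CC :: "'a topology \<Rightarrow> 'a rel \<Rightarrow> 'a set set" where
  "CC X r = {C. C \<noteq> {} \<and> closedin X C \<and> C \<in> Chains r}"

definition CC_topology :: "'a topology \<Rightarrow> 'a rel \<Rightarrow> 'a set topology" where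
  "CC_topology X r = topology_generated_by
     ({{C \<in> CC X r. C \<subseteq> V} | V. clopenin X V} \<union>
      {{C \<in> CC X r. C \<inter> V \<noteq> {}} | V. clopenin X V})"

definition CC_order :: "'a topology \<Rightarrow> 'a rel \<Rightarrow> 'a set rel" where
  "CC_order X r = {(C\<^sub>1, C\<^sub>2). C\<^sub>1 \<in> CC X r \<and> C\<^sub>2 \<in> CC X r \<and> upset_of r C\<^sub>1 C\<^sub>2}"

definition tensor :: "('i \<Rightarrow> 'a topology) \<Rightarrow> ('i \<Rightarrow> 'a rel) \<Rightarrow> 'i set \<Rightarrow> ('i \<Rightarrow> 'a) set set" where
  "tensor Y r I =
     {C \<in> CC (product_topology Y I) (product_order Y r I).
        \<forall>i\<in>I. upset_of (r i) (topspace (Y i)) ((\<lambda>x. x i) ` C)}"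

definition tensor_topology ::
  "('i \<Rightarrow> 'a topology) \<Rightarrow> ('i \<Rightarrow> 'a rel) \<Rightarrow> 'i set \<Rightarrow> ('i \<Rightarrow> 'a) set topology" where
  "tensor_topology Y r I =
     subtopology (CC_topology (product_topology Y I) (product_order Y r I)) (tensor Y r I)"

definition tensor_order ::
  "('i \<Rightarrow> 'a topology) \<Rightarrow> ('i \<Rightarrow> 'a rel) \<Rightarrow> 'i set \<Rightarrow> ('i \<Rightarrow> 'a) set rel" where
  "tensor_order Y r I =
     CC_order (product_topology Y I) (product_order Y r I) \<inter> (tensor Y r I \<times> tensor Y r I)"

definition least_element :: "'a rel \<Rightarrow> 'a set \<Rightarrow> 'a" where
  "least_element r C = (THE x. x \<in> C \<and> (\<forall>y\<in>C. (x, y) \<in> r))"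

definition tensor_proj ::
  "('i \<Rightarrow> 'a topology) \<Rightarrow> ('i \<Rightarrow> 'a rel) \<Rightarrow> 'i set \<Rightarrow> 'i \<Rightarrow> ('i \<Rightarrow> 'a) set \<Rightarrow> 'a" where
  "tensor_proj Y r I i C = least_element (product_order Y r I) C i"

end

theory Submission
  imports Defs
begin

text \<open>
  For a Priestley space \<open>X\<close>, the closed chains of \<open>X\<close> form an Esakia root system. They are a closed
  subspace of the Vietoris hyperspace, so compactness follows from Alexander's subbase theorem;
  closed upsets of a chain are linearly ordered by inclusion; and the downset of an open set is open
  because cutting a chain with a clopen upset of \<open>X\<close> is a continuous operation. The tensor product
  is a closed upset of the space of closed chains of the product, hence again an Esakia root system.

  If \<open>C\<close> is in the tensor product, its closed upsets include all \<open>C \<inter> \<up>c\<close> with \<open>c \<in> C\<close>, so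
  the upset \<open>\<pi>\<^sub>i[C]\<close>, which is generated by \<open>p\<^sub>i(C)\<close>, is the image of the principal
  upset of \<open>C\<close> under \<open>p\<^sub>i\<close>. A cone \<open>f\<^sub>i : Z \<rightarrow> Y\<^sub>i\<close> with tupling \<open>F\<close> lifts to
  \<open>z \<mapsto> F[\<up>z]\<close>. This lift is forced: for any lift \<open>h\<close> the least element of \<open>h(w)\<close> is \<open>F(w)\<close>,
  and the points of \<open>h(z)\<close> are the least elements of the \<open>h(w)\<close> with \<open>w \<ge> z\<close>.
\<close>

subsection \<open>Separation in Priestley spaces\<close>

lemma clopenin_Un: "clopenin X U \<Longrightarrow> clopenin X V \<Longrightarrow> clopenin X (U \<union> V)"
  by (auto simp: clopenin_def)

lemma clopenin_Int: "clopenin X U \<Longrightarrow> clopenin X V \<Longrightarrow> clopenin X (U \<inter> V)"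
  by (auto simp: clopenin_def)

lemma clopenin_diff: "clopenin X U \<Longrightarrow> clopenin X V \<Longrightarrow> clopenin X (U - V)"
  by (auto simp: clopenin_def)

lemma clopenin_compl: "clopenin X V \<Longrightarrow> clopenin X (topspace X - V)"
  by (auto simp: clopenin_def)

lemma clopenin_topspace: "clopenin X (topspace X)"
  by (auto simp: clopenin_def)

lemma clopenin_subset: "clopenin X V \<Longrightarrow> V \<subseteq> topspace X"
  by (auto simp: clopenin_def dest: openin_subset)

lemma clopenin_Union: "finite \<F> \<Longrightarrow> (\<And>U. U \<in> \<F> \<Longrightarrow> clopenin X U) \<Longrightarrow> clopenin X (\<Union>\<F>)"
  by (auto simp: clopenin_def intro: closedin_Union)

lemma clopenin_continuous_preimage:
  assumes "continuous_map X Y f" "clopenin Y V"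
  shows "clopenin X {x \<in> topspace X. f x \<in> V}"
  using assms by (auto simp: clopenin_def intro: openin_continuous_map_preimage closedin_continuous_map_preimage)

lemma upset_of_compl:
  "r \<subseteq> A \<times> A \<Longrightarrow> upset_of r A U \<Longrightarrow> upset_of (r\<inverse>) A (A - U)"
  by (auto simp: upset_of_def)

lemma upset_of_Union: "(\<And>U. U \<in> \<F> \<Longrightarrow> upset_of r A U) \<Longrightarrow> upset_of r A (\<Union>\<F>)"
  by (fastforce simp: upset_of_def)

lemma priestley_space_order:
  assumes "priestley_space X r"
  shows "r \<subseteq> topspace X \<times> topspace X"
    and "x \<in> topspace X \<Longrightarrow> (x, x) \<in> r"
    and "(x, y) \<in> r \<Longrightarrow> (y, z) \<in> r \<Longrightarrow> (x, z) \<in> r"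
    and "(x, y) \<in> r \<Longrightarrow> (y, x) \<in> r \<Longrightarrow> x = y"
  using assms
  by (auto simp: priestley_space_def partial_order_on_def preorder_on_def refl_on_def
      elim: transE dest: antisymD)

lemma priestley_space_compact: "priestley_space X r \<Longrightarrow> compact_space X"
  by (simp add: priestley_space_def)

lemma priestley_space_sep:
  assumes "priestley_space X r" "x \<in> topspace X" "y \<in> topspace X" "(x, y) \<notin> r"
  shows "\<exists>U. clopenin X U \<and> upset_of r (topspace X) U \<and> x \<in> U \<and> y \<notin> U"
  using assms unfolding priestley_space_def by blast

text \<open>Complements of clopen upsets are clopen downsets, so separation survives reversal of the
  order; facts about downsets then give facts about upsets.\<close>

lemma priestley_space_converse:
  assumes "priestley_space X r"
  shows "priestley_space X (r\<inverse>)"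
  unfolding priestley_space_def
proof (intro conjI ballI impI)
  show "compact_space X" "partial_order_on (topspace X) (r\<inverse>)"
    using assms by (auto simp: priestley_space_def)
  fix x y assume xy: "x \<in> topspace X" "y \<in> topspace X" "(x, y) \<notin> r\<inverse>"
  then obtain U where U: "clopenin X U" "upset_of r (topspace X) U" "y \<in> U" "x \<notin> U"
    using priestley_space_sep[OF assms, of y x] by auto
  have "upset_of (r\<inverse>) (topspace X) (topspace X - U)"
    using U(2) by (rule upset_of_compl[OF priestley_space_order(1)[OF assms]])
  then show "\<exists>U. clopenin X U \<and> upset_of (r\<inverse>) (topspace X) U \<and> x \<in> U \<and> y \<notin> U"
    using U xy clopenin_compl[OF U(1)] by blast
qed

text \<open>For distinct points one of the two inequalities fails, and a clopen upset or its
  complement separates them. Since every subset of the carrier is an upset for equality, order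
  separation becomes separation by arbitrary clopen sets.\<close>

lemma priestley_space_discrete_order:
  assumes "priestley_space X r"
  shows "priestley_space X (Id_on (topspace X))"
  unfolding priestley_space_def
proof (intro conjI ballI impI)
  show "compact_space X"
    using assms by (rule priestley_space_compact)
  show "partial_order_on (topspace X) (Id_on (topspace X))"
    by (auto simp: partial_order_on_def preorder_on_def refl_on_def trans_def antisym_def)
  fix x y assume xy: "x \<in> topspace X" "y \<in> topspace X" "(x, y) \<notin> Id_on (topspace X)"
  then have "(x, y) \<notin> r \<or> (y, x) \<notin> r"
    using priestley_space_order(4)[OF assms] by blast
  then obtain V where V: "clopenin X V" "x \<in> V \<longleftrightarrow> y \<notin> V"
    using priestley_space_sep[OF assms, of x y] priestley_space_sep[OF assms, of y x] xy by blast
  define U where "U = (if x \<in> V then V else topspace X - V)"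
  have "clopenin X U" "x \<in> U" "y \<notin> U"
    using V xy by (auto simp: U_def clopenin_compl)
  moreover have "upset_of (Id_on (topspace X)) (topspace X) U"
    using clopenin_subset[OF \<open>clopenin X U\<close>] by (auto simp: upset_of_def)
  ultimately show "\<exists>U. clopenin X U \<and> upset_of (Id_on (topspace X)) (topspace X) U \<and> x \<in> U \<and> y \<notin> U"
    by blast
qed

lemma priestley_space_Hausdorff:
  assumes "priestley_space X r"
  shows "Hausdorff_space X"
  unfolding Hausdorff_space_def
proof (intro allI impI)
  fix x y assume xy: "x \<in> topspace X \<and> y \<in> topspace X \<and> x \<noteq> y"
  then obtain U where "clopenin X U" "x \<in> U" "y \<notin> U"
    using priestley_space_sep[OF priestley_space_discrete_order[OF assms], of x y] by blast
  with xy show "\<exists>U V. openin X U \<and> openin X V \<and> x \<in> U \<and> y \<in> V \<and> disjnt U V"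
    by (intro exI[of _ U] exI[of _ "topspace X - U"]) (auto simp: clopenin_def disjnt_def)
qed

text \<open>Each point of \<open>F\<close> has a clopen downset around it that misses
  \<open>x\<close>. Finitely many cover \<open>F\<close> by compactness, and the complement of their
  union is the required upset. Downsets are encoded as upsets of \<open>r\<inverse>\<close>.\<close>

lemma priestley_space_sep_point_closed:
  assumes P: "priestley_space X r" and x: "x \<in> topspace X" and F: "closedin X F"
    and not_le: "\<And>y. y \<in> F \<Longrightarrow> (x, y) \<notin> r"
  shows "\<exists>U. clopenin X U \<and> upset_of r (topspace X) U \<and> x \<in> U \<and> U \<inter> F = {}"
proof -
  let ?\<U> = "{W. clopenin X W \<and> upset_of (r\<inverse>) (topspace X) W \<and> x \<notin> W}"
  have "F \<subseteq> \<Union>?\<U>"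
  proof
    fix y assume "y \<in> F"
    then have "\<exists>W. clopenin X W \<and> upset_of (r\<inverse>) (topspace X) W \<and> y \<in> W \<and> x \<notin> W"
      using not_le closedin_subset[OF F] x
      by (intro priestley_space_sep[OF priestley_space_converse[OF P]]) auto
    then show "y \<in> \<Union>?\<U>" by blast
  qed
  moreover have "openin X W" if "W \<in> ?\<U>" for W
    using that by (simp add: clopenin_def)
  ultimately obtain \<F> where \<F>: "finite \<F>" "\<F> \<subseteq> ?\<U>" "F \<subseteq> \<Union>\<F>"
    using compactinD[OF closedin_compact_space[OF priestley_space_compact[OF P] F], of ?\<U>]
    by meson
  let ?U = "topspace X - \<Union>\<F>"
  have "clopenin X (\<Union>\<F>)"
    using \<F> by (intro clopenin_Union) auto
  moreover have "upset_of (r\<inverse>) (topspace X) (\<Union>\<F>)"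
    using \<F> by (intro upset_of_Union) auto
  ultimately have "clopenin X ?U" "upset_of r (topspace X) ?U"
    using priestley_space_order(1)[OF P] upset_of_compl[of "r\<inverse>" "topspace X" "\<Union>\<F>"]
    by (auto simp: clopenin_compl)
  moreover have "x \<in> ?U" "?U \<inter> F = {}"
    using \<F> x by auto
  ultimately show ?thesis by blast
qed

text \<open>A second round of compactness: each point of \<open>C\<close> has a clopen upset
  avoiding \<open>F\<close>, and finitely many of these cover \<open>C\<close>.\<close>

lemma priestley_space_sep_closed:
  assumes P: "priestley_space X r" and C: "closedin X C" and F: "closedin X F"
    and not_le: "\<And>x y. x \<in> C \<Longrightarrow> y \<in> F \<Longrightarrow> (x, y) \<notin> r"
  shows "\<exists>U. clopenin X U \<and> upset_of r (topspace X) U \<and> C \<subseteq> U \<and> U \<inter> F = {}"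
proof -
  let ?\<U> = "{W. clopenin X W \<and> upset_of r (topspace X) W \<and> W \<inter> F = {}}"
  have "C \<subseteq> \<Union>?\<U>"
  proof
    fix x assume "x \<in> C"
    then have "\<exists>U. clopenin X U \<and> upset_of r (topspace X) U \<and> x \<in> U \<and> U \<inter> F = {}"
      using not_le closedin_subset[OF C] by (intro priestley_space_sep_point_closed[OF P _ F]) auto
    then show "x \<in> \<Union>?\<U>" by blast
  qed
  moreover have "openin X W" if "W \<in> ?\<U>" for W
    using that by (simp add: clopenin_def)
  ultimately obtain \<F> where \<F>: "finite \<F>" "\<F> \<subseteq> ?\<U>" "C \<subseteq> \<Union>\<F>"
    using compactinD[OF closedin_compact_space[OF priestley_space_compact[OF P] C], of ?\<U>]
    by meson
  have "clopenin X (\<Union>\<F>)"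
    using \<F> by (intro clopenin_Union) auto
  moreover have "upset_of r (topspace X) (\<Union>\<F>)"
    using \<F> by (intro upset_of_Union) auto
  moreover have "\<Union>\<F> \<inter> F = {}"
    using \<F> by blast
  ultimately show ?thesis using \<F>(3) by blast
qed

text \<open>This is the ordered separation applied to equality as the order, where "not below" means
  "distinct".\<close>

lemma priestley_space_clopen_sep:
  assumes "priestley_space X r" "closedin X C" "closedin X F" "C \<inter> F = {}"
  shows "\<exists>V. clopenin X V \<and> C \<subseteq> V \<and> V \<inter> F = {}"
proof -
  have "\<exists>U. clopenin X U \<and> upset_of (Id_on (topspace X)) (topspace X) U \<and> C \<subseteq> U \<and> U \<inter> F = {}"
    using assms by (intro priestley_space_sep_closed priestley_space_discrete_order) auto
  then show ?thesis by blast
qed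

lemma closedin_priestley_sing:
  "priestley_space X r \<Longrightarrow> x \<in> topspace X \<Longrightarrow> closedin X {x}"
  by (simp add: closedin_Hausdorff_singleton priestley_space_Hausdorff)

text \<open>A point outside the downset lies below no point of \<open>F\<close>, so some clopen
  upset around it avoids \<open>F\<close>. Being an upset, it also avoids everything below
  \<open>F\<close>.\<close>

lemma closedin_priestley_downset:
  assumes P: "priestley_space X r" and F: "closedin X F"
  shows "closedin X (r\<inverse> `` F)"
proof -
  have "\<exists>T. openin X T \<and> x \<in> T \<and> T \<subseteq> topspace X - r\<inverse> `` F" if x: "x \<in> topspace X - r\<inverse> `` F" for x
  proof -
    have "\<exists>U. clopenin X U \<and> upset_of r (topspace X) U \<and> x \<in> U \<and> U \<inter> F = {}"
      using x by (intro priestley_space_sep_point_closed[OF P _ F]) auto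
    then obtain U where U: "clopenin X U" "upset_of r (topspace X) U" "x \<in> U" "U \<inter> F = {}"
      by blast
    have "U \<inter> r\<inverse> `` F = {}"
      using U(2,4) closedin_subset[OF F] unfolding upset_of_def by blast
    then show ?thesis
      using U clopenin_subset[OF U(1)] by (intro exI[of _ U]) (auto simp: clopenin_def)
  qed
  then have "openin X (topspace X - r\<inverse> `` F)"
    by (subst openin_subopen) blast
  moreover have "r\<inverse> `` F \<subseteq> topspace X"
    using priestley_space_order(1)[OF P] by blast
  ultimately show ?thesis
    by (simp add: closedin_def)
qed

lemma closedin_priestley_upset:
  "priestley_space X r \<Longrightarrow> closedin X F \<Longrightarrow> closedin X (r `` F)"
  using closedin_priestley_downset[OF priestley_space_converse] by fastforce

text \<open>Differences of clopen upsets form a base. \<open>W\<close> removes the points above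
  \<open>x\<close> that lie outside \<open>S\<close>; the points outside both \<open>S\<close> and
  \<open>W\<close> are then not above \<open>x\<close>, so \<open>U\<close> can avoid them.\<close>

lemma priestley_space_convex_nbhd:
  assumes P: "priestley_space X r" and S: "openin X S" "x \<in> S"
  shows "\<exists>U W. clopenin X U \<and> upset_of r (topspace X) U \<and>
    clopenin X W \<and> upset_of r (topspace X) W \<and> x \<in> U - W \<and> U - W \<subseteq> S"
proof -
  have x: "x \<in> topspace X"
    using S openin_subset by blast
  have sing: "closedin X {x}"
    by (rule closedin_priestley_sing[OF P x])
  have "\<exists>W. clopenin X W \<and> upset_of r (topspace X) W \<and> (r `` {x} - S) \<subseteq> W \<and> W \<inter> {x} = {}"
  proof (rule priestley_space_sep_closed[OF P _ sing])
    show "closedin X (r `` {x} - S)"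
      by (simp add: S closedin_diff closedin_priestley_upset[OF P sing])
    \<comment> \<open>By antisymmetry a point both above and below \<open>x\<close> is
      \<open>x\<close> itself, which lies in \<open>S\<close>.\<close>
    show "(y, z) \<notin> r" if "y \<in> r `` {x} - S" "z \<in> {x}" for y z
      using that priestley_space_order(4)[OF P, of x y] S(2) by blast
  qed
  then obtain W where W: "clopenin X W" "upset_of r (topspace X) W" "r `` {x} - S \<subseteq> W" "x \<notin> W"
    by blast
  have "\<exists>U. clopenin X U \<and> upset_of r (topspace X) U \<and> x \<in> U \<and> U \<inter> (topspace X - S - W) = {}"
  proof (rule priestley_space_sep_point_closed[OF P x])
    show "closedin X (topspace X - S - W)"
      using W S by (auto simp: clopenin_def intro: closedin_diff)
    show "(x, y) \<notin> r" if "y \<in> topspace X - S - W" for y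
      using that W(3) by blast
  qed
  then obtain U where U: "clopenin X U" "upset_of r (topspace X) U" "x \<in> U" "U \<inter> (topspace X - S - W) = {}"
    by blast
  have "U - W \<subseteq> S"
    using U(4) clopenin_subset[OF U(1)] by blast
  then show ?thesis
    using U W by blast
qed

text \<open>Differences of clopen upsets form a base of \<open>Y\<close>, and preimages commute with
  differences. The criterion serves for the tensor projections, where preimages of clopen upsets are
  easy to compute.\<close>

lemma continuous_map_priestley:
  assumes P: "priestley_space Y s" and f: "\<And>x. x \<in> topspace X \<Longrightarrow> f x \<in> topspace Y"
    and pre: "\<And>U. clopenin Y U \<Longrightarrow> upset_of s (topspace Y) U \<Longrightarrow> clopenin X {x \<in> topspace X. f x \<in> U}"
  shows "continuous_map X Y f"
  unfolding continuous_map_def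
proof (intro conjI allI impI)
  show "f \<in> topspace X \<rightarrow> topspace Y"
    using f by blast
  fix S assume S: "openin Y S"
  show "openin X {x \<in> topspace X. f x \<in> S}"
  proof (subst openin_subopen, intro ballI)
    fix x assume x: "x \<in> {x \<in> topspace X. f x \<in> S}"
    then obtain U W where UW: "clopenin Y U" "upset_of s (topspace Y) U"
      "clopenin Y W" "upset_of s (topspace Y) W" "f x \<in> U - W" "U - W \<subseteq> S"
      using priestley_space_convex_nbhd[OF P S, of "f x"] by blast
    let ?T = "{x \<in> topspace X. f x \<in> U} - {x \<in> topspace X. f x \<in> W}"
    have "clopenin X ?T"
      using UW by (intro clopenin_diff pre)
    then have "openin X ?T \<and> x \<in> ?T \<and> ?T \<subseteq> {x \<in> topspace X. f x \<in> S}"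
      using UW(5,6) x by (auto simp: clopenin_def)
    then show "\<exists>T. openin X T \<and> x \<in> T \<and> T \<subseteq> {x \<in> topspace X. f x \<in> S}"
      by blast
  qed
qed

text \<open>The closed sets of elements of \<open>C\<close> below a given element of
  \<open>C\<close> have the finite intersection property, because finite subsets of a chain are
  bounded below in it. Compactness gives a common point.\<close>

lemma priestley_chain_least:
  assumes P: "priestley_space X r" and C: "C \<in> CC X r"
  obtains m where "m \<in> C" "\<And>y. y \<in> C \<Longrightarrow> (m, y) \<in> r"
proof -
  have cl: "closedin X C" "C \<in> Chains r" and "C \<noteq> {}"
    using C by (auto simp: CC_def)
  have sub: "C \<subseteq> topspace X"
    using cl by (simp add: closedin_subset)
  define \<U> where "\<U> = (\<lambda>c. C \<inter> r\<inverse> `` {c}) ` C"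
  \<comment> \<open>The bound is sought in \<open>C\<close> rather than in \<open>B\<close>, so that
    the empty subfamily is covered as well, by \<open>C \<noteq> {}\<close>.\<close>
  have fin: "\<exists>m\<in>C. \<forall>c\<in>B. (m, c) \<in> r" if "finite B" "B \<subseteq> C" for B
    using that
  proof (induction B)
    case empty
    then show ?case using \<open>C \<noteq> {}\<close> by blast
  next
    case (insert b B)
    then obtain m where m: "m \<in> C" "\<forall>c\<in>B. (m, c) \<in> r" by blast
    consider "(m, b) \<in> r" | "(b, m) \<in> r"
      using cl insert m unfolding Chains_def by blast
    then show ?case
    proof cases
      case 1
      then show ?thesis using m by blast
    next
      case 2
      then have "\<forall>c\<in>insert b B. (b, c) \<in> r"
        using m sub insert priestley_space_order(2,3)[OF P] by blast
      then show ?thesis using insert by blast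
    qed
  qed
  have "\<Inter>\<U> \<noteq> {}"
  proof (rule compact_space_fip[THEN iffD1, rule_format, OF priestley_space_compact[OF P]], intro conjI ballI allI impI)
    fix D assume "D \<in> \<U>"
    then show "closedin X D"
      using sub unfolding \<U>_def
      by (auto intro!: closedin_Int cl closedin_priestley_downset[OF P] closedin_priestley_sing[OF P])
  next
    fix \<F> assume "finite \<F> \<and> \<F> \<subseteq> \<U>"
    then obtain B where "finite B" "B \<subseteq> C" "\<F> = (\<lambda>c. C \<inter> r\<inverse> `` {c}) ` B"
      unfolding \<U>_def by (meson finite_subset_image)
    then show "\<Inter>\<F> \<noteq> {}"
      using fin[of B] by blast
  qed
  then show thesis
    using that \<open>C \<noteq> {}\<close> unfolding \<U>_def by blast
qed

lemma least_element_eq: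
  assumes P: "priestley_space X r" and "m \<in> C" "\<And>y. y \<in> C \<Longrightarrow> (m, y) \<in> r"
  shows "least_element r C = m"
  unfolding least_element_def using assms(2,3) priestley_space_order(4)[OF P] by blast

lemma least_element_CC:
  assumes P: "priestley_space X r" and C: "C \<in> CC X r"
  shows "least_element r C \<in> C" and "y \<in> C \<Longrightarrow> (least_element r C, y) \<in> r"
  using priestley_chain_least[OF P C] least_element_eq[OF P] by metis+

subsection \<open>The space of closed chains\<close>

text \<open>\<open>Alexander_subbase\<close> speaks of unions of finite intersections relative to
  \<open>\<Union>\<B>\<close>. Each of the two topologies is the coarsest one containing the
  subbase, so they coincide.\<close>

lemma compact_space_generated_by:
  assumes fin: "\<And>\<C>. \<lbrakk>\<C> \<subseteq> \<B>; \<Union>\<C> = \<Union>\<B>\<rbrakk> \<Longrightarrow> \<exists>\<C>'. finite \<C>' \<and> \<C>' \<subseteq> \<C> \<and> \<Union>\<C>' = \<Union>\<B>"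
  shows "compact_space (topology_generated_by \<B>)"
proof (rule Alexander_subbase[of \<B>])
  let ?T = "topology (arbitrary union_of (finite intersection_of (\<lambda>x. x \<in> \<B>) relative_to \<Union>\<B>))"
  have "openin ?T = openin (topology_generated_by \<B>)"
  proof (intro ext iffI)
    fix S assume "openin ?T S"
    then show "openin (topology_generated_by \<B>) S"
      by (rule minimal_topology_subbase[rotated 2])
        (auto simp: topology_generated_by_Basis openin_topspace[of "topology_generated_by \<B>", simplified])
  next
    fix S assume "openin (topology_generated_by \<B>) S"
    then have "generate_topology_on \<B> S"
      by (rule openin_topology_generated_by)
    then show "openin ?T S"
    proof (rule generate_topology_on_coarsest[rotated 2])
      fix S assume "S \<in> \<B>"
      then have "(finite intersection_of (\<lambda>x. x \<in> \<B>) relative_to \<Union>\<B>) S"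
        by (metis Union_upper finite_intersection_of_inc inf.absorb2 relative_to_inc)
      then show "openin ?T S"
        by (simp add: arbitrary_union_of_inc istopology_subbase topology_inverse')
    qed simp
  qed
  then show "?T = topology_generated_by \<B>"
    by (simp add: topology_eq)
qed (use fin in simp)

text \<open>The box of \<open>topspace X\<close> is all of \<open>CC X r\<close>, so the subbase
  covers the carrier.\<close>

lemma topspace_CC: "topspace (CC_topology X r) = CC X r"
proof -
  have "{C \<in> CC X r. C \<subseteq> topspace X} = CC X r"
    by (auto simp: CC_def dest: closedin_subset)
  then have "CC X r \<in> {{C \<in> CC X r. C \<subseteq> V} | V. clopenin X V}"
    using clopenin_topspace by blast
  then have "CC X r \<subseteq> topspace (CC_topology X r)"
    unfolding CC_topology_def topology_generated_by_topspace by (intro Union_upper UnI1)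
  moreover have "topspace (CC_topology X r) \<subseteq> CC X r"
    unfolding CC_topology_def topology_generated_by_topspace by auto
  ultimately show ?thesis by (rule antisym[rotated])
qed

lemma openin_CC_box: "clopenin X V \<Longrightarrow> openin (CC_topology X r) {C \<in> CC X r. C \<subseteq> V}"
  unfolding CC_topology_def by (rule topology_generated_by_Basis) blast

lemma openin_CC_dia: "clopenin X V \<Longrightarrow> openin (CC_topology X r) {C \<in> CC X r. C \<inter> V \<noteq> {}}"
  unfolding CC_topology_def by (rule topology_generated_by_Basis) blast

text \<open>The complement of the box of \<open>V\<close> is the diamond of the complement of
  \<open>V\<close>; the next lemma uses the same duality in the other direction.\<close>

lemma clopenin_CC_box:
  assumes "clopenin X V"
  shows "clopenin (CC_topology X r) {C \<in> CC X r. C \<subseteq> V}"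
proof -
  have "CC X r - {C \<in> CC X r. C \<subseteq> V} = {C \<in> CC X r. C \<inter> (topspace X - V) \<noteq> {}}"
    by (auto simp: CC_def dest: closedin_subset)
  then show ?thesis
    using openin_CC_box[OF assms] openin_CC_dia[OF clopenin_compl[OF assms]]
    by (auto simp: clopenin_def closedin_def topspace_CC)
qed

lemma clopenin_CC_dia:
  assumes "clopenin X V"
  shows "clopenin (CC_topology X r) {C \<in> CC X r. C \<inter> V \<noteq> {}}"
proof -
  have "CC X r - {C \<in> CC X r. C \<inter> V \<noteq> {}} = {C \<in> CC X r. C \<subseteq> topspace X - V}"
    by (auto simp: CC_def dest: closedin_subset)
  then show ?thesis
    using openin_CC_dia[OF assms] openin_CC_box[OF clopenin_compl[OF assms]]
    by (auto simp: clopenin_def closedin_def topspace_CC)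
qed

text \<open>Boxes are closed under intersection, so one box and finitely many diamonds suffice for a
  basic neighbourhood. A lone diamond is paired with the trivial box of \<open>topspace X\<close>, a
  lone box with no diamonds.\<close>

lemma CC_topology_basis:
  assumes "openin (CC_topology X r) \<V>" "C \<in> \<V>"
  shows "\<exists>V \<W>. clopenin X V \<and> finite \<W> \<and> (\<forall>W\<in>\<W>. clopenin X W) \<and>
    C \<subseteq> V \<and> (\<forall>W\<in>\<W>. C \<inter> W \<noteq> {}) \<and> {D \<in> CC X r. D \<subseteq> V \<and> (\<forall>W\<in>\<W>. D \<inter> W \<noteq> {})} \<subseteq> \<V>"
proof -
  have "C \<in> CC X r"
    using assms openin_subset topspace_CC by blast
  have "generate_topology_on ({{C \<in> CC X r. C \<subseteq> V} | V. clopenin X V} \<union>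
      {{C \<in> CC X r. C \<inter> V \<noteq> {}} | V. clopenin X V}) \<V>"
    using assms(1) unfolding CC_topology_def by (rule openin_topology_generated_by)
  then show ?thesis
    using assms(2)
  proof induction
    case (Int a b)
    then have C: "C \<in> a" "C \<in> b" by blast+
    from Int.IH(1)[OF C(1)] obtain V \<W> where 1:
      "clopenin X V" "finite \<W>" "\<forall>W\<in>\<W>. clopenin X W"
      "C \<subseteq> V" "\<forall>W\<in>\<W>. C \<inter> W \<noteq> {}" "{D \<in> CC X r. D \<subseteq> V \<and> (\<forall>W\<in>\<W>. D \<inter> W \<noteq> {})} \<subseteq> a"
      by (elim exE conjE) (rule that; assumption)
    from Int.IH(2)[OF C(2)] obtain V' \<W>' where 2:
      "clopenin X V'" "finite \<W>'" "\<forall>W\<in>\<W>'. clopenin X W"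
      "C \<subseteq> V'" "\<forall>W\<in>\<W>'. C \<inter> W \<noteq> {}" "{D \<in> CC X r. D \<subseteq> V' \<and> (\<forall>W\<in>\<W>'. D \<inter> W \<noteq> {})} \<subseteq> b"
      by (elim exE conjE) (rule that; assumption)
    have "{D \<in> CC X r. D \<subseteq> V \<inter> V' \<and> (\<forall>W\<in>\<W> \<union> \<W>'. D \<inter> W \<noteq> {})} \<subseteq> a \<inter> b"
      using subsetD[OF 1(6)] subsetD[OF 2(6)] by (intro subsetI) simp
    then show ?case
      using 1 2 by (intro exI[of _ "V \<inter> V'"] exI[of _ "\<W> \<union> \<W>'"]) (auto intro: clopenin_Int)
  next
    case (UN K)
    then obtain k where k: "k \<in> K" "C \<in> k" by blast
    show ?case
      using UN.IH[OF k] k(1) by (meson Union_upper subset_trans)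
  next
    case (Basis s)
    then consider V where "clopenin X V" "s = {C \<in> CC X r. C \<subseteq> V}"
      | W where "clopenin X W" "s = {C \<in> CC X r. C \<inter> W \<noteq> {}}"
      by blast
    then show ?case
    proof cases
      case 1
      then show ?thesis
        using Basis by (intro exI[of _ V] exI[of _ "{}"]) auto
    next
      case 2
      then show ?thesis
        using Basis \<open>C \<in> CC X r\<close> closedin_subset[of X C]
        by (intro exI[of _ "topspace X"] exI[of _ "{W}"]) (auto simp: clopenin_topspace CC_def)
    qed
  qed auto
qed

section \<open>Compactness of the space of closed chains\<close>

text \<open>With the full relation every set is a chain, so \<open>CC X UNIV\<close> is the Vietoris hyperspace of
  all nonempty closed sets.\<close>

lemma CC_UNIV: "CC X UNIV = {C. C \<noteq> {} \<and> closedin X C}"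
  by (auto simp: CC_def Chains_def)

text \<open>For a subbasic cover, \<open>K\<close> is what the diamond sets \<open>\<W>\<close>
  leave uncovered. If \<open>K\<close> is empty, finitely many members of \<open>\<W>\<close> cover
  \<open>X\<close>, and their diamonds cover the hyperspace. Otherwise \<open>K\<close> is itself a
  point, lies in no diamond of the cover, and so lies in some box of \<open>V\<close>; then
  \<open>V\<close> and finitely many members of \<open>\<W>\<close> cover \<open>X\<close>, and a
  closed set not inside \<open>V\<close> meets one of the latter.\<close>

lemma compact_space_CC_UNIV:
  assumes X: "compact_space X"
  shows "compact_space (CC_topology X UNIV)"
  unfolding CC_topology_def
proof (rule compact_space_generated_by)
  let ?box = "\<lambda>V. {C \<in> CC X UNIV. C \<subseteq> V}" and ?dia = "\<lambda>V. {C \<in> CC X UNIV. C \<inter> V \<noteq> {}}"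
  let ?B = "{?box V | V. clopenin X V} \<union> {?dia V | V. clopenin X V}"
  have un: "\<Union>?B = CC X UNIV"
    using topspace_CC[of X UNIV] unfolding CC_topology_def topology_generated_by_topspace .
  fix \<C> assume \<C>: "\<C> \<subseteq> ?B" "\<Union>\<C> = \<Union>?B"
  define \<W> where "\<W> = {W. clopenin X W \<and> ?dia W \<in> \<C>}"
  define K where "K = topspace X - \<Union>\<W>"
  have "\<exists>\<C>'. finite \<C>' \<and> \<C>' \<subseteq> \<C> \<and> CC X UNIV \<subseteq> \<Union>\<C>'"
  proof (cases "K = {}")
    case True
    then have "topspace X \<subseteq> \<Union>\<W>"
      by (simp add: K_def)
    moreover have "\<forall>W\<in>\<W>. openin X W"
      by (simp add: \<W>_def clopenin_def)
    ultimately obtain \<F> where \<F>: "finite \<F>" "\<F> \<subseteq> \<W>" "topspace X \<subseteq> \<Union>\<F>"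
      using X unfolding compact_space_alt by meson
    have "CC X UNIV \<subseteq> \<Union>(?dia ` \<F>)"
      using \<F>(3) unfolding CC_UNIV by (fastforce dest: closedin_subset)
    then show ?thesis
      using \<F> unfolding \<W>_def by (intro exI[of _ "?dia ` \<F>"]) auto
  next
    case False
    have "closedin X K"
      unfolding K_def by (intro closedin_diff) (auto simp: \<W>_def clopenin_def)
    then have K: "K \<in> CC X UNIV"
      using False by (simp add: CC_UNIV)
    then have "K \<in> \<Union>\<C>"
      by (simp only: \<C>(2) un)
    then obtain S where S: "S \<in> \<C>" "K \<in> S" by blast
    have "S \<noteq> ?dia W" if "clopenin X W" for W
    proof
      assume "S = ?dia W"
      then have "W \<in> \<W>" "K \<inter> W \<noteq> {}"
        using S that by (auto simp: \<W>_def)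
      then show False unfolding K_def by blast
    qed
    moreover have "S \<in> ?B"
      by (rule subsetD[OF \<C>(1) S(1)])
    ultimately obtain V where V: "clopenin X V" "S = ?box V"
      by auto
    have "topspace X \<subseteq> \<Union>(insert V \<W>)"
      using S(2) V unfolding K_def by auto
    moreover have "\<forall>W\<in>insert V \<W>. openin X W"
      using V by (simp add: \<W>_def clopenin_def)
    ultimately obtain \<F> where \<F>: "finite \<F>" "\<F> \<subseteq> insert V \<W>" "topspace X \<subseteq> \<Union>\<F>"
      using X unfolding compact_space_alt by meson
    have "D \<in> \<Union>(insert S (?dia ` (\<F> \<inter> \<W>)))" if D: "D \<in> CC X UNIV" for D
    proof (cases "D \<subseteq> V")
      case True
      then show ?thesis using D V by blast
    next
      case False
      then obtain d where "d \<in> D" "d \<notin> V" by blast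
      moreover have "d \<in> topspace X"
        using D \<open>d \<in> D\<close> closedin_subset unfolding CC_UNIV by blast
      ultimately obtain W where "W \<in> \<F> \<inter> \<W>" "d \<in> W"
        using \<F> by blast
      then show ?thesis using D \<open>d \<in> D\<close> by blast
    qed
    then show ?thesis
      using \<F>(1) S(1) by (intro exI[of _ "insert S (?dia ` (\<F> \<inter> \<W>))"]) (auto simp: \<W>_def)
  qed
  then show "\<exists>\<C>'. finite \<C>' \<and> \<C>' \<subseteq> \<C> \<and> \<Union>\<C>' = \<Union>?B"
    using un Union_mono[of _ \<C>] \<C>(2) by (metis subset_antisym)
qed

text \<open>Incomparable points \<open>a\<close>, \<open>b\<close> of \<open>C\<close> have clopen
  upsets \<open>U\<close>, \<open>U'\<close>, each containing just one of them. A point of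
  \<open>U - U'\<close> is never comparable with one of \<open>U' - U\<close>, so the two diamonds
  give a neighbourhood of \<open>C\<close> without chains.\<close>

lemma closedin_CC_UNIV:
  assumes P: "priestley_space X r"
  shows "closedin (CC_topology X UNIV) (CC X r)"
proof -
  have "\<exists>\<T>. openin (CC_topology X UNIV) \<T> \<and> C \<in> \<T> \<and> \<T> \<subseteq> CC X UNIV - CC X r"
    if C: "C \<in> CC X UNIV - CC X r" for C
  proof -
    obtain a b where ab: "a \<in> C" "b \<in> C" "(a, b) \<notin> r" "(b, a) \<notin> r"
      using C unfolding CC_def Chains_def by blast
    moreover have "a \<in> topspace X" "b \<in> topspace X"
      using C ab(1,2) closedin_subset unfolding CC_UNIV by blast+
    ultimately obtain U U' where
      U: "clopenin X U" "upset_of r (topspace X) U" "a \<in> U" "b \<notin> U" and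
      U': "clopenin X U'" "upset_of r (topspace X) U'" "b \<in> U'" "a \<notin> U'"
      using priestley_space_sep[OF P] by meson
    let ?dia = "\<lambda>V. {C \<in> CC X UNIV. C \<inter> V \<noteq> {}}"
    let ?T = "?dia (U - U') \<inter> ?dia (U' - U)"
    have "openin (CC_topology X UNIV) ?T"
      by (intro openin_Int openin_CC_dia clopenin_diff U U')
    moreover have "C \<in> ?T"
      using C ab U U' by blast
    moreover have "D \<notin> CC X r" if "D \<in> ?T" for D
    proof -
      from that obtain u u' where "u \<in> D" "u' \<in> D" "u \<in> U - U'" "u' \<in> U' - U"
        by blast
      moreover from this have "(u, u') \<notin> r" "(u', u) \<notin> r"
        using U U' clopenin_subset[OF U(1)] clopenin_subset[OF U'(1)] unfolding upset_of_def by blast+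
      ultimately show ?thesis
        unfolding CC_def Chains_def by blast
    qed
    ultimately show ?thesis by blast
  qed
  then have "openin (CC_topology X UNIV) (CC X UNIV - CC X r)"
    by (subst openin_subopen) blast
  moreover have "CC X r \<subseteq> CC X UNIV"
    by (auto simp: CC_def Chains_def)
  ultimately show ?thesis
    by (simp add: closedin_def topspace_CC)
qed

text \<open>Boxes and diamonds of \<open>CC X r\<close> are traces of those of the hyperspace. Hence
  the identity is continuous from a closed, therefore compact, subspace onto
  \<open>CC_topology X r\<close>.\<close>

lemma compact_space_CC:
  assumes P: "priestley_space X r"
  shows "compact_space (CC_topology X r)"
proof -
  have sub: "CC X r \<subseteq> CC X UNIV"
    by (auto simp: CC_def Chains_def)
  let ?S = "subtopology (CC_topology X UNIV) (CC X r)"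
  have S: "topspace ?S = CC X r"
    using sub by (auto simp: topspace_CC)
  have "continuous_map ?S (CC_topology X r) id"
    unfolding CC_topology_def[of X r]
  proof (rule continuous_on_generated_topo)
    fix \<U> assume "\<U> \<in> {{C \<in> CC X r. C \<subseteq> V} | V. clopenin X V} \<union> {{C \<in> CC X r. C \<inter> V \<noteq> {}} | V. clopenin X V}"
    then consider V where "clopenin X V" "\<U> = {C \<in> CC X UNIV. C \<subseteq> V} \<inter> CC X r"
      | V where "clopenin X V" "\<U> = {C \<in> CC X UNIV. C \<inter> V \<noteq> {}} \<inter> CC X r"
      using sub by blast
    then have "openin ?S \<U>"
    proof cases
      case 1
      then show ?thesis
        using openin_CC_box[of X V UNIV] openin_subtopology_Int by blast
    next
      case 2
      then show ?thesis
        using openin_CC_dia[of X V UNIV] openin_subtopology_Int by blast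
    qed
    moreover have "\<U> \<subseteq> topspace ?S"
      using calculation openin_subset by blast
    ultimately show "openin ?S (id -` \<U> \<inter> topspace ?S)"
      by (simp add: Int_absorb2)
  next
    show "id ` topspace ?S \<subseteq> \<Union>({{C \<in> CC X r. C \<subseteq> V} | V. clopenin X V} \<union> {{C \<in> CC X r. C \<inter> V \<noteq> {}} | V. clopenin X V})"
      using topspace_CC[of X r, unfolded CC_topology_def topology_generated_by_topspace]
      by (simp only: S image_id id_apply order_refl)
  qed
  moreover have "compactin ?S (CC X r)"
  proof (rule compactin_subtopology[THEN iffD2], intro conjI)
    have "compact_space (CC_topology X UNIV)"
      by (rule compact_space_CC_UNIV[OF priestley_space_compact[OF P]])
    then show "compactin (CC_topology X UNIV) (CC X r)"
      by (rule closedin_compact_space[OF _ closedin_CC_UNIV[OF P]])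
  qed simp
  ultimately have "compactin (CC_topology X r) (id ` CC X r)"
    by (rule image_compactin[rotated])
  then show ?thesis
    by (simp add: compact_space_def topspace_CC)
qed

section \<open>The order on closed chains\<close>

lemma CC_subset_topspace: "C \<in> CC X r \<Longrightarrow> C \<subseteq> topspace X"
  by (simp add: CC_def closedin_subset)

lemma partial_order_CC: "partial_order_on (CC X r) (CC_order X r)"
  unfolding partial_order_on_def preorder_on_def
proof (intro conjI)
  show "refl_on (CC X r) (CC_order X r)"
    by (auto simp: refl_on_def CC_order_def upset_of_def)
  show "trans (CC_order X r)"
    unfolding trans_def CC_order_def upset_of_def by blast
  show "antisym (CC_order X r)"
    unfolding antisym_def CC_order_def upset_of_def by blast
qed (auto simp: CC_order_def)

lemma CC_closed_upset:
  assumes "C \<in> CC X r" "closedin X D" "D \<noteq> {}" "upset_of r C D"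
  shows "(C, D) \<in> CC_order X r"
proof -
  have "D \<subseteq> C"
    using assms(4) by (simp add: upset_of_def)
  then show ?thesis
    using assms unfolding CC_order_def CC_def Chains_def by blast
qed

lemma upset_of_CC_order:
  assumes "\<And>C D. C \<in> \<U> \<Longrightarrow> (C, D) \<in> CC_order X r \<Longrightarrow> D \<in> \<U>" "\<U> \<subseteq> CC X r"
  shows "upset_of (CC_order X r) (CC X r) \<U>"
  using assms unfolding upset_of_def by blast

text \<open>If \<open>C\<close> is not below \<open>D\<close>, either \<open>D\<close> has a point
  outside \<open>C\<close> and a box around \<open>C\<close> separates them, or some
  \<open>y\<close> in \<open>C - D\<close> lies above some \<open>x\<close> in \<open>D\<close>,
  where a box must be joined with a diamond.\<close>

lemma priestley_space_CC:
  assumes P: "priestley_space X r"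
  shows "priestley_space (CC_topology X r) (CC_order X r)"
  unfolding priestley_space_def topspace_CC
proof (intro conjI ballI impI)
  fix C D assume C: "C \<in> CC X r" and D: "D \<in> CC X r" and not_le: "(C, D) \<notin> CC_order X r"
  have clo: "closedin X C" "closedin X D" and sub: "C \<subseteq> topspace X" "D \<subseteq> topspace X"
    using C D CC_subset_topspace[of C X r] CC_subset_topspace[of D X r] by (auto simp: CC_def)
  consider x where "x \<in> D" "x \<notin> C" | x y where "x \<in> D" "y \<in> C" "y \<notin> D" "(x, y) \<in> r"
    using C D not_le unfolding CC_order_def upset_of_def by blast
  then show "\<exists>\<U>. clopenin (CC_topology X r) \<U> \<and> upset_of (CC_order X r) (CC X r) \<U> \<and> C \<in> \<U> \<and> D \<notin> \<U>"
  proof cases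
    case 1
    then have "\<exists>V. clopenin X V \<and> C \<subseteq> V \<and> V \<inter> {x} = {}"
      using sub by (intro priestley_space_clopen_sep[OF P clo(1)] closedin_priestley_sing[OF P]) auto
    then obtain V where V: "clopenin X V" "C \<subseteq> V" "x \<notin> V" by blast
    moreover have "upset_of (CC_order X r) (CC X r) {C \<in> CC X r. C \<subseteq> V}"
      by (rule upset_of_CC_order) (auto simp: CC_order_def upset_of_def)
    ultimately show ?thesis
      using 1 C clopenin_CC_box[OF V(1), of r] by blast
  next
    case 2
    have "(y, x) \<notin> r"
      using 2 priestley_space_order(4)[OF P] by blast
    then obtain U where U: "clopenin X U" "upset_of r (topspace X) U" "y \<in> U" "x \<notin> U"
      using 2 sub priestley_space_sep[OF P, of y x] by blast
    have "\<exists>V. clopenin X V \<and> {y} \<subseteq> V \<and> V \<inter> D = {}"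
      using 2 sub by (intro priestley_space_clopen_sep[OF P _ clo(2)] closedin_priestley_sing[OF P]) auto
    then obtain V where V: "clopenin X V" "y \<in> V" "V \<inter> D = {}" by blast
    \<comment> \<open>If an upset \<open>E'\<close> of a chain \<open>E\<close> has a point
      \<open>d\<close> outside \<open>U\<close>, then all of \<open>E \<inter> U\<close> lies above
      \<open>d\<close>, hence in \<open>E'\<close>, so meeting \<open>U \<inter> V\<close> is
      inherited by \<open>E'\<close>. The set omits \<open>D\<close>, because \<open>x\<close> is
      outside \<open>U\<close> and \<open>V\<close> misses \<open>D\<close>.\<close>
    let ?\<U> = "{C \<in> CC X r. C \<subseteq> U} \<union> {C \<in> CC X r. C \<inter> (U \<inter> V) \<noteq> {}}"
    have "clopenin (CC_topology X r) ?\<U>"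
      by (intro clopenin_Un clopenin_CC_box clopenin_CC_dia clopenin_Int U V)
    moreover have "upset_of (CC_order X r) (CC X r) ?\<U>"
    proof (rule upset_of_CC_order)
      fix E E' assume E: "E \<in> ?\<U>" and le: "(E, E') \<in> CC_order X r"
      then have E': "E' \<in> CC X r" "E' \<subseteq> E" "upset_of r E E'" "E \<in> Chains r" "E' \<subseteq> topspace X"
        using CC_subset_topspace[of E' X r] by (auto simp: CC_order_def CC_def upset_of_def)
      show "E' \<in> ?\<U>"
      proof (cases "E' \<subseteq> U")
        case True
        then show ?thesis using E' by blast
      next
        case False
        then obtain d where d: "d \<in> E'" "d \<notin> U" by blast
        then obtain b where b: "b \<in> E" "b \<in> U \<inter> V"
          using E E'(2) by blast
        have "(b, d) \<notin> r"
          using U(2) b d E'(5) unfolding upset_of_def by blast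
        then have "(d, b) \<in> r"
          using E'(2,4) b(1) d(1) unfolding Chains_def by blast
        then have "b \<in> E'"
          using E'(3) b(1) d(1) unfolding upset_of_def by blast
        then show ?thesis using b E'(1) by blast
      qed
    qed blast
    moreover have "C \<in> ?\<U>" "D \<notin> ?\<U>"
      using C 2 U V by blast+
    ultimately show ?thesis by blast
  qed
qed (use compact_space_CC[OF P] partial_order_CC in auto)

text \<open>If \<open>U\<close> is a clopen upset of \<open>X\<close> containing \<open>C\<close> but no point of \<open>D - V\<close>, then \<open>E \<inter> U\<close> is a
  closed upset of \<open>E\<close> that stays close to \<open>C\<close> when \<open>E\<close> is close to \<open>D\<close>.\<close>

lemma openin_CC_downset:
  assumes P: "priestley_space X r" and \<V>: "openin (CC_topology X r) \<V>"
  shows "openin (CC_topology X r) ((CC_order X r)\<inverse> `` \<V>)"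
proof (subst openin_subopen, intro ballI)
  fix D assume "D \<in> (CC_order X r)\<inverse> `` \<V>"
  then obtain C where C: "C \<in> \<V>" "C \<in> CC X r" "D \<in> CC X r" "upset_of r D C"
    by (auto simp: CC_order_def)
  obtain V \<W> where VW: "clopenin X V" "finite \<W>" "\<forall>W\<in>\<W>. clopenin X W" "C \<subseteq> V"
    "\<forall>W\<in>\<W>. C \<inter> W \<noteq> {}" "{D \<in> CC X r. D \<subseteq> V \<and> (\<forall>W\<in>\<W>. D \<inter> W \<noteq> {})} \<subseteq> \<V>"
    using CC_topology_basis[OF \<V> C(1)] by blast
  have "\<exists>U. clopenin X U \<and> upset_of r (topspace X) U \<and> C \<subseteq> U \<and> U \<inter> (D - V) = {}"
  proof (rule priestley_space_sep_closed[OF P])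
    show "closedin X C" "closedin X (D - V)"
      using C VW(1) by (auto simp: CC_def clopenin_def intro: closedin_diff)
    \<comment> \<open>A point of \<open>D\<close> above a point of \<open>C\<close> lies in
      \<open>C\<close>, hence in \<open>V\<close>.\<close>
    show "(x, y) \<notin> r" if "x \<in> C" "y \<in> D - V" for x y
      using that C(4) VW(4) unfolding upset_of_def by blast
  qed
  then obtain U where U: "clopenin X U" "upset_of r (topspace X) U" "C \<subseteq> U" "U \<inter> (D - V) = {}"
    by blast
  let ?dia = "\<lambda>V. {C \<in> CC X r. C \<inter> V \<noteq> {}}"
  \<comment> \<open>The box forces \<open>E \<inter> U \<subseteq> V\<close>. The additional index
    \<open>topspace X\<close> forces \<open>E \<inter> U\<close> to be nonempty even when
    \<open>\<W>\<close> is empty.\<close>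
  let ?\<T> = "{E \<in> CC X r. E \<subseteq> topspace X - (U - V)} \<inter> \<Inter>((\<lambda>W. ?dia (U \<inter> W)) ` insert (topspace X) \<W>)"
  have "openin (CC_topology X r) ?\<T>"
  proof (intro openin_Int openin_Inter)
    show "openin (CC_topology X r) {E \<in> CC X r. E \<subseteq> topspace X - (U - V)}"
      by (intro openin_CC_box clopenin_compl clopenin_diff U VW)
    fix \<S> assume "\<S> \<in> (\<lambda>W. ?dia (U \<inter> W)) ` insert (topspace X) \<W>"
    then obtain W where "clopenin X W" "\<S> = ?dia (U \<inter> W)"
      using VW(3) clopenin_topspace by blast
    then show "openin (CC_topology X r) \<S>"
      by (simp only:) (intro openin_CC_dia clopenin_Int U)
  qed (use VW in auto)
  moreover have "D \<in> ?\<T>"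
  proof -
    have "C \<subseteq> D" "C \<noteq> {}" "D \<subseteq> topspace X"
      using C CC_subset_topspace[of D X r] by (auto simp: upset_of_def CC_def)
    moreover have "D \<inter> (U \<inter> W) \<noteq> {}" if "W \<in> \<W>" for W
      using VW(5) that \<open>C \<subseteq> D\<close> U(3) by blast
    moreover have "D \<inter> (U \<inter> topspace X) \<noteq> {}"
      using U(3) \<open>C \<noteq> {}\<close> \<open>C \<subseteq> D\<close> \<open>D \<subseteq> topspace X\<close> by blast
    ultimately show ?thesis
      using C(3) U(4) by auto
  qed
  moreover have "E \<in> (CC_order X r)\<inverse> `` \<V>" if E: "E \<in> ?\<T>" for E
  proof -
    have dia: "E \<in> ?dia (U \<inter> W)" if "W \<in> insert (topspace X) \<W>" for W
      by (rule InterD[OF IntD2[OF E]]) (use that in blast)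
    have E': "E \<in> CC X r" "E \<inter> (U - V) = {}" "E \<inter> U \<noteq> {}" "\<And>W. W \<in> \<W> \<Longrightarrow> E \<inter> (U \<inter> W) \<noteq> {}"
      using IntD1[OF E] dia[of "topspace X"] dia by blast+
    have "closedin X (E \<inter> U)"
      using E'(1) U(1) by (auto simp: CC_def clopenin_def)
    moreover have "upset_of r E (E \<inter> U)"
      using U(2) CC_subset_topspace[OF E'(1)] unfolding upset_of_def by blast
    ultimately have le: "(E, E \<inter> U) \<in> CC_order X r"
      using E' CC_closed_upset by blast
    then have "E \<inter> U \<in> {D \<in> CC X r. D \<subseteq> V \<and> (\<forall>W\<in>\<W>. D \<inter> W \<noteq> {})}"
      using E' by (auto simp: CC_order_def Int_assoc)
    then show ?thesis
      using le VW(6) by blast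
  qed
  ultimately show "\<exists>\<T>. openin (CC_topology X r) \<T> \<and> D \<in> \<T> \<and> \<T> \<subseteq> (CC_order X r)\<inverse> `` \<V>"
    by (intro exI[of _ ?\<T>] conjI subsetI)
qed

text \<open>Downsets of clopen sets are open by the preceding lemma and closed by the Priestley
  property. Two upsets of one chain are comparable by inclusion, and the smaller is then an upset of
  the larger.\<close>

lemma esakia_root_system_CC:
  assumes P: "priestley_space X r"
  shows "esakia_root_system (CC_topology X r) (CC_order X r)"
  unfolding esakia_root_system_def topspace_CC
proof (intro conjI allI impI ballI)
  show "priestley_space (CC_topology X r) (CC_order X r)"
    by (rule priestley_space_CC[OF P])
  show "clopenin (CC_topology X r) ((CC_order X r)\<inverse> `` \<V>)" if "clopenin (CC_topology X r) \<V>" for \<V>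
    using that openin_CC_downset[OF P] closedin_priestley_downset[OF priestley_space_CC[OF P]]
    by (simp add: clopenin_def)
  fix C assume "C \<in> CC X r"
  show "CC_order X r `` {C} \<in> Chains (CC_order X r)"
    unfolding Chains_def
  proof (intro CollectI ballI)
    fix D D' assume D: "D \<in> CC_order X r `` {C}" "D' \<in> CC_order X r `` {C}"
    then have up: "upset_of r C D" "upset_of r C D'" and "C \<in> Chains r"
      by (auto simp: CC_order_def CC_def)
    have "D \<subseteq> D' \<or> D' \<subseteq> D"
    proof (rule ccontr)
      assume "\<not> ?thesis"
      then obtain d d' where d: "d \<in> D" "d \<notin> D'" "d' \<in> D'" "d' \<notin> D" by blast
      then have "d \<in> C" "d' \<in> C" using up unfolding upset_of_def by blast+
      then have "(d, d') \<in> r \<or> (d', d) \<in> r"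
        using \<open>C \<in> Chains r\<close> unfolding Chains_def by blast
      then show False
        using d up \<open>d \<in> C\<close> \<open>d' \<in> C\<close> unfolding upset_of_def by blast
    qed
    then show "(D, D') \<in> CC_order X r \<or> (D', D) \<in> CC_order X r"
      using D unfolding CC_order_def upset_of_def by blast
  qed
qed

subsection \<open>The tensor product as an Esakia root system\<close>

lemma esakia_root_systemD:
  assumes "esakia_root_system X r"
  shows "priestley_space X r"
    and "clopenin X V \<Longrightarrow> clopenin X (r\<inverse> `` V)"
    and "(x, y) \<in> r \<Longrightarrow> (x, z) \<in> r \<Longrightarrow> (y, z) \<in> r \<or> (z, y) \<in> r"
proof -
  show P: "priestley_space X r" and "clopenin X V \<Longrightarrow> clopenin X (r\<inverse> `` V)"
    using assms by (simp_all add: esakia_root_system_def)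
  assume "(x, y) \<in> r" "(x, z) \<in> r"
  moreover from this have "x \<in> topspace X"
    using priestley_space_order(1)[OF P] by blast
  ultimately show "(y, z) \<in> r \<or> (z, y) \<in> r"
    using assms unfolding esakia_root_system_def Chains_def by blast
qed

text \<open>A clopen subset of \<open>K\<close> is the trace of a clopen \<open>V'\<close> of
  \<open>X\<close>. As \<open>K\<close> is an upset, the downset of the trace taken in
  \<open>K\<close> is the trace of the downset of \<open>V'\<close>.\<close>

lemma esakia_root_system_closed_upset:
  assumes E: "esakia_root_system X r" and K: "closedin X K" "upset_of r (topspace X) K"
  shows "esakia_root_system (subtopology X K) (r \<inter> K \<times> K)"
proof -
  note P = esakia_root_systemD(1)[OF E]
  have sub: "K \<subseteq> topspace X"
    using K(1) by (rule closedin_subset)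
  then have top: "topspace (subtopology X K) = K"
    by auto
  have clopen_Int: "clopenin (subtopology X K) (K \<inter> V)" if "clopenin X V" for V
    using that openin_subtopology_Int2[of X V K] closedin_subtopology_Int_closed[of X V K]
    by (simp add: clopenin_def)
  show ?thesis
    unfolding esakia_root_system_def top
  proof (intro conjI allI impI ballI)
    show "priestley_space (subtopology X K) (r \<inter> K \<times> K)"
      unfolding priestley_space_def top
    proof (intro conjI ballI impI)
      show "compact_space (subtopology X K)"
        using K(1) P by (simp add: closedin_compact_space compact_space_subtopology priestley_space_compact)
      show "partial_order_on K (r \<inter> K \<times> K)"
        unfolding partial_order_on_def preorder_on_def
      proof (intro conjI)
        show "refl_on K (r \<inter> K \<times> K)"
          using priestley_space_order(2)[OF P] sub by (auto simp: refl_on_def)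
        show "trans (r \<inter> K \<times> K)"
          by (rule transI) (use priestley_space_order(3)[OF P] in blast)
        show "antisym (r \<inter> K \<times> K)"
          by (rule antisymI) (use priestley_space_order(4)[OF P] in blast)
      qed blast
      fix x y assume "x \<in> K" "y \<in> K" "(x, y) \<notin> r \<inter> K \<times> K"
      then obtain U where U: "clopenin X U" "upset_of r (topspace X) U" "x \<in> U" "y \<notin> U"
        using priestley_space_sep[OF P, of x y] sub by blast
      have "upset_of (r \<inter> K \<times> K) K (K \<inter> U)"
        using U(2) sub unfolding upset_of_def by blast
      then show "\<exists>U. clopenin (subtopology X K) U \<and> upset_of (r \<inter> K \<times> K) K U \<and> x \<in> U \<and> y \<notin> U"
        using clopen_Int[OF U(1)] U(3,4) \<open>x \<in> K\<close> by blast
    qed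
  next
    fix V assume V: "clopenin (subtopology X K) V"
    then have "closedin (subtopology X K) (K - V)"
      using clopenin_compl[OF V] unfolding top by (simp add: clopenin_def)
    \<comment> \<open>Both pieces are closed in \<open>X\<close> because \<open>K\<close> is, so a
      clopen set of \<open>X\<close> separates them.\<close>
    then have "closedin X V" "closedin X (K - V)"
      using V K(1) closedin_trans_full unfolding clopenin_def by blast+
    then have "\<exists>V'. clopenin X V' \<and> V \<subseteq> V' \<and> V' \<inter> (K - V) = {}"
      by (intro priestley_space_clopen_sep[OF P]) auto
    then obtain V' where V': "clopenin X V'" "V \<subseteq> V'" "V' \<inter> (K - V) = {}"
      by blast
    moreover have "V \<subseteq> K"
      using clopenin_subset[OF V] by simp
    ultimately have "V = K \<inter> V'" by blast
    then have "(r \<inter> K \<times> K)\<inverse> `` V = K \<inter> r\<inverse> `` V'"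
      using K(2) clopenin_subset[OF V'(1)] unfolding upset_of_def by blast
    then show "clopenin (subtopology X K) ((r \<inter> K \<times> K)\<inverse> `` V)"
      using clopen_Int esakia_root_systemD(2)[OF E V'(1)] by simp
  next
    fix y assume "y \<in> K"
    show "(r \<inter> K \<times> K) `` {y} \<in> Chains (r \<inter> K \<times> K)"
      unfolding Chains_def using esakia_root_systemD(3)[OF E, of y] by blast
  qed
qed

section \<open>Products, and the tensor product as a closed upset\<close>

lemma priestley_space_product:
  assumes P: "\<And>i. i \<in> I \<Longrightarrow> priestley_space (Y i) (r i)"
  shows "priestley_space (product_topology Y I) (product_order Y r I)"
  unfolding priestley_space_def
proof (intro conjI ballI impI)
  let ?X = "topspace (product_topology Y I)"
  show "compact_space (product_topology Y I)"
    unfolding compact_space_product_topology using priestley_space_compact[OF P] by blast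
  show "partial_order_on ?X (product_order Y r I)"
    unfolding partial_order_on_def preorder_on_def
  proof (intro conjI)
    show "product_order Y r I \<subseteq> ?X \<times> ?X"
      unfolding product_order_def by blast
    show "refl_on ?X (product_order Y r I)"
      using priestley_space_order(2)[OF P] by (auto simp: refl_on_def product_order_def)
    show "trans (product_order Y r I)"
    proof (rule transI)
      fix x y z assume "(x, y) \<in> product_order Y r I" "(y, z) \<in> product_order Y r I"
      then show "(x, z) \<in> product_order Y r I"
        unfolding product_order_def using priestley_space_order(3)[OF P] by blast
    qed
    show "antisym (product_order Y r I)"
    proof (rule antisymI)
      fix x y assume "(x, y) \<in> product_order Y r I" "(y, x) \<in> product_order Y r I"
      \<comment> \<open>Points of the product are extensional functions, so agreement on
        \<open>I\<close> is equality.\<close>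
      then have "x \<in> extensional I" "y \<in> extensional I" "\<And>i. i \<in> I \<Longrightarrow> x i = y i"
        using priestley_space_order(4)[OF P] by (auto simp: product_order_def PiE_def)
      then show "x = y" by (rule extensionalityI)
    qed
  qed
  fix x y assume xy: "x \<in> ?X" "y \<in> ?X" "(x, y) \<notin> product_order Y r I"
  \<comment> \<open>A coordinate where the inequality fails supplies the separating upset, which is
    pulled back along the projection.\<close>
  then obtain i where i: "i \<in> I" "(x i, y i) \<notin> r i"
    unfolding product_order_def by blast
  have "x i \<in> topspace (Y i)" "y i \<in> topspace (Y i)"
    using xy i(1) by auto
  then obtain U where U: "clopenin (Y i) U" "upset_of (r i) (topspace (Y i)) U" "x i \<in> U" "y i \<notin> U"
    using priestley_space_sep[OF P[OF i(1)]] i by blast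
  let ?U = "{z \<in> ?X. z i \<in> U}"
  have "clopenin (product_topology Y I) ?U"
    using continuous_map_product_projection[OF i(1), of Y] U(1) by (rule clopenin_continuous_preimage)
  moreover have "upset_of (product_order Y r I) ?X ?U"
    unfolding upset_of_def
  proof (intro conjI ballI impI)
    fix a b assume "a \<in> ?U" "b \<in> ?X" "(a, b) \<in> product_order Y r I"
    then have "a i \<in> U" "b i \<in> topspace (Y i)" "(a i, b i) \<in> r i"
      using i(1) by (auto simp: product_order_def)
    then show "b \<in> ?U"
      using U(2) \<open>b \<in> ?X\<close> unfolding upset_of_def by blast
  qed blast
  ultimately show "\<exists>U. clopenin (product_topology Y I) U \<and> upset_of (product_order Y r I) ?X U \<and> x \<in> U \<and> y \<notin> U"
    using xy(1) U(3,4) by (intro exI[of _ ?U]) simp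
qed

text \<open>A value \<open>b\<close> above \<open>a = d i\<close> is attained at some
  \<open>c\<close> in \<open>C\<close>. If \<open>c\<close> is above \<open>d\<close>, it lies in
  \<open>D\<close>. Otherwise \<open>c\<close> is below \<open>d\<close>, so \<open>b\<close> is
  also below \<open>a\<close> and antisymmetry gives \<open>b = a\<close>.\<close>

lemma tensor_upset:
  assumes P: "\<And>i. i \<in> I \<Longrightarrow> priestley_space (Y i) (r i)"
    and C: "C \<in> tensor Y r I" and le: "(C, D) \<in> CC_order (product_topology Y I) (product_order Y r I)"
  shows "D \<in> tensor Y r I"
proof -
  let ?r = "product_order Y r I"
  have D: "D \<in> CC (product_topology Y I) ?r" "upset_of ?r C D" "C \<in> Chains ?r" "D \<subseteq> C"
    using le by (auto simp: CC_order_def CC_def upset_of_def)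
  have "upset_of (r i) (topspace (Y i)) ((\<lambda>x. x i) ` D)" if i: "i \<in> I" for i
    unfolding upset_of_def
  proof (intro conjI ballI impI)
    have up: "upset_of (r i) (topspace (Y i)) ((\<lambda>x. x i) ` C)"
      using C i by (simp add: tensor_def)
    then show "(\<lambda>x. x i) ` D \<subseteq> topspace (Y i)"
      using D(4) unfolding upset_of_def by blast
    fix a b assume "a \<in> (\<lambda>x. x i) ` D" "b \<in> topspace (Y i)" "(a, b) \<in> r i"
    then obtain d c where d: "d \<in> D" "a = d i" and c: "c \<in> C" "b = c i"
      using up D(4) unfolding upset_of_def by blast
    consider "(d, c) \<in> ?r" | "(c, d) \<in> ?r"
      using D(3,4) c(1) d(1) unfolding Chains_def by blast
    then show "b \<in> (\<lambda>x. x i) ` D"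
    proof cases
      case 1
      then show ?thesis
        using D(2) c d(1) unfolding upset_of_def by blast
    next
      case 2
      then have "(b, a) \<in> r i"
        using i c d by (simp add: product_order_def)
      then have "a = b"
        using priestley_space_order(4)[OF P[OF i]] \<open>(a, b) \<in> r i\<close> by blast
      then show ?thesis using d by blast
    qed
  qed
  then show ?thesis
    using D(1) by (simp add: tensor_def)
qed

text \<open>If coordinate \<open>i\<close> fails, some \<open>y\<close> above \<open>c i\<close>
  lies outside the projection of \<open>C\<close>, which is closed, so a clopen \<open>V\<close>
  around \<open>y\<close> misses it. Chains whose projection meets the downset of \<open>V\<close>
  but not \<open>V\<close> form a neighbourhood of \<open>C\<close> outside the tensor product; it
  is open because the downset of \<open>V\<close> is clopen in \<open>Y i\<close>.\<close>

lemma closedin_tensor: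
  assumes E: "\<And>i. i \<in> I \<Longrightarrow> esakia_root_system (Y i) (r i)"
  shows "closedin (CC_topology (product_topology Y I) (product_order Y r I)) (tensor Y r I)"
proof -
  let ?X = "product_topology Y I" and ?r = "product_order Y r I"
  have "\<exists>\<T>. openin (CC_topology ?X ?r) \<T> \<and> C \<in> \<T> \<and> \<T> \<subseteq> CC ?X ?r - tensor Y r I"
    if C: "C \<in> CC ?X ?r - tensor Y r I" for C
  proof -
    have clo: "closedin ?X C" and sub: "C \<subseteq> topspace ?X"
      using C CC_subset_topspace[of C ?X ?r] by (simp_all add: CC_def)
    obtain i where i: "i \<in> I" and no_up: "\<not> upset_of (r i) (topspace (Y i)) ((\<lambda>x. x i) ` C)"
      using C by (auto simp: tensor_def)
    note Ei = E[OF i] and Pi = esakia_root_systemD(1)[OF E[OF i]]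
    have proj: "continuous_map ?X (Y i) (\<lambda>x. x i)"
      by (rule continuous_map_product_projection[OF i])
    have sub_i: "(\<lambda>x. x i) ` C \<subseteq> topspace (Y i)"
      using sub i by auto
    obtain c y where c: "c \<in> C" and y: "y \<in> topspace (Y i)" "(c i, y) \<in> r i" "y \<notin> (\<lambda>x. x i) ` C"
      using no_up sub_i unfolding upset_of_def by blast
    have "closed_map ?X (Y i) (\<lambda>x. x i)"
      using E by (intro continuous_imp_closed_map proj priestley_space_Hausdorff[OF Pi]
          priestley_space_compact[OF priestley_space_product] esakia_root_systemD(1))
    then have clo_i: "closedin (Y i) ((\<lambda>x. x i) ` C)"
      using clo by (simp add: closed_map_def)
    have "\<exists>V. clopenin (Y i) V \<and> {y} \<subseteq> V \<and> V \<inter> (\<lambda>x. x i) ` C = {}"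
      using y by (intro priestley_space_clopen_sep[OF Pi _ clo_i] closedin_priestley_sing[OF Pi]) auto
    then obtain V where V: "clopenin (Y i) V" "y \<in> V" "V \<inter> (\<lambda>x. x i) ` C = {}"
      by blast
    let ?pre = "\<lambda>V. {x \<in> topspace ?X. x i \<in> V}"
    let ?T = "{D \<in> CC ?X ?r. D \<inter> ?pre ((r i)\<inverse> `` V) \<noteq> {}} \<inter> {D \<in> CC ?X ?r. D \<subseteq> ?pre (topspace (Y i) - V)}"
    have "openin (CC_topology ?X ?r) ?T"
      by (intro openin_Int openin_CC_box openin_CC_dia clopenin_continuous_preimage[OF proj]
          esakia_root_systemD(2)[OF Ei] clopenin_compl V)
    moreover have "c \<in> C \<inter> ?pre ((r i)\<inverse> `` V)" "C \<subseteq> ?pre (topspace (Y i) - V)"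
      using c sub y(2) V(2,3) sub_i by blast+
    then have "C \<in> ?T"
      using C by blast
    moreover have "D \<notin> tensor Y r I" if D: "D \<in> ?T" for D
    proof
      assume "D \<in> tensor Y r I"
      then have "upset_of (r i) (topspace (Y i)) ((\<lambda>x. x i) ` D)"
        using i by (simp add: tensor_def)
      moreover from D obtain d where "d \<in> D" "d i \<in> (r i)\<inverse> `` V"
        by blast
      then obtain v where "v \<in> V" "(d i, v) \<in> r i"
        by blast
      ultimately have "v \<in> (\<lambda>x. x i) ` D"
        using clopenin_subset[OF V(1)] \<open>d \<in> D\<close> unfolding upset_of_def by blast
      then show False
        using D \<open>v \<in> V\<close> by blast
    qed
    then have "?T \<subseteq> CC ?X ?r - tensor Y r I"
      by blast
    ultimately show ?thesis
      by (intro exI[of _ ?T] conjI)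
  qed
  then have "openin (CC_topology ?X ?r) (CC ?X ?r - tensor Y r I)"
    by (subst openin_subopen) blast
  moreover have "tensor Y r I \<subseteq> CC ?X ?r"
    by (auto simp: tensor_def)
  ultimately show ?thesis
    by (simp add: closedin_def topspace_CC)
qed

lemma topspace_tensor: "topspace (tensor_topology Y r I) = tensor Y r I"
  by (auto simp: tensor_topology_def topspace_CC tensor_def)

lemma esakia_root_system_tensor:
  assumes E: "\<And>i. i \<in> I \<Longrightarrow> esakia_root_system (Y i) (r i)"
  shows "esakia_root_system (tensor_topology Y r I) (tensor_order Y r I)"
  unfolding tensor_topology_def tensor_order_def
proof (rule esakia_root_system_closed_upset)
  have P: "priestley_space (Y i) (r i)" if "i \<in> I" for i
    using E[OF that] by (rule esakia_root_systemD)
  show "esakia_root_system (CC_topology (product_topology Y I) (product_order Y r I))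
      (CC_order (product_topology Y I) (product_order Y r I))"
    by (intro esakia_root_system_CC priestley_space_product P)
  show "closedin (CC_topology (product_topology Y I) (product_order Y r I)) (tensor Y r I)"
    by (rule closedin_tensor[OF E])
  show "upset_of (CC_order (product_topology Y I) (product_order Y r I))
     (topspace (CC_topology (product_topology Y I) (product_order Y r I))) (tensor Y r I)"
    unfolding topspace_CC
  proof (rule upset_of_CC_order)
    show "D \<in> tensor Y r I"
      if "C \<in> tensor Y r I" "(C, D) \<in> CC_order (product_topology Y I) (product_order Y r I)" for C D
      using P that by (rule tensor_upset)
  qed (auto simp: tensor_def)
qed

subsection \<open>Projections and the universal property\<close>

lemma continuous_p_morphismD:
  assumes "continuous_p_morphism X r Y s g"
  shows "continuous_map X Y g"
    and "x \<in> topspace X \<Longrightarrow> g ` (r `` {x}) = s `` {g x}"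
    and "x \<in> topspace X \<Longrightarrow> (x, y) \<in> r \<Longrightarrow> (g x, g y) \<in> s"
  using assms unfolding continuous_p_morphism_def by blast+

lemma tensor_CC: "C \<in> tensor Y r I \<Longrightarrow> C \<in> CC (product_topology Y I) (product_order Y r I)"
  by (simp add: tensor_def)

lemma tensor_closed_upset:
  assumes P: "\<And>i. i \<in> I \<Longrightarrow> priestley_space (Y i) (r i)"
    and C: "C \<in> tensor Y r I" and D: "closedin (product_topology Y I) D" "D \<noteq> {}"
      "upset_of (product_order Y r I) C D"
  shows "(C, D) \<in> tensor_order Y r I"
proof -
  have le: "(C, D) \<in> CC_order (product_topology Y I) (product_order Y r I)"
    by (rule CC_closed_upset[OF tensor_CC[OF C] D])
  moreover have "D \<in> tensor Y r I"
    using P C le by (rule tensor_upset)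
  ultimately show ?thesis
    using C by (simp add: tensor_order_def)
qed

lemma tensor_least:
  assumes P: "\<And>i. i \<in> I \<Longrightarrow> priestley_space (Y i) (r i)" and C: "C \<in> tensor Y r I"
  shows "least_element (product_order Y r I) C \<in> C"
    and "c \<in> C \<Longrightarrow> (least_element (product_order Y r I) C, c) \<in> product_order Y r I"
proof -
  note prod = priestley_space_product[of I Y r, OF P]
  show "least_element (product_order Y r I) C \<in> C"
    by (rule least_element_CC(1)[OF prod tensor_CC[OF C]])
  show "c \<in> C \<Longrightarrow> (least_element (product_order Y r I) C, c) \<in> product_order Y r I"
    by (rule least_element_CC(2)[OF prod tensor_CC[OF C]])
qed

text \<open>The witness is the part of \<open>C\<close> above \<open>c\<close>. That every point of
  \<open>C\<close> is the least element of some member above \<open>C\<close> yields both the back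
  condition for the projections and the uniqueness of lifts.\<close>

lemma tensor_principal_upset:
  assumes P: "\<And>i. i \<in> I \<Longrightarrow> priestley_space (Y i) (r i)"
    and C: "C \<in> tensor Y r I" and c: "c \<in> C"
  obtains D where "(C, D) \<in> tensor_order Y r I" "least_element (product_order Y r I) D = c"
proof -
  let ?X = "product_topology Y I" and ?r = "product_order Y r I"
  note prod = priestley_space_product[of I Y r, OF P]
  let ?D = "C \<inter> ?r `` {c}"
  have clo: "closedin ?X C" and sub: "C \<subseteq> topspace ?X"
    using tensor_CC[OF C] CC_subset_topspace[of C ?X ?r] by (simp_all add: CC_def)
  have "closedin ?X {c}"
    using sub c by (intro closedin_priestley_sing[OF prod]) auto
  then have "closedin ?X ?D"
    by (intro closedin_Int clo closedin_priestley_upset[OF prod])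
  moreover have "c \<in> ?D"
    using priestley_space_order(2)[OF prod, of c] c sub by blast
  moreover have "upset_of ?r C ?D"
    unfolding upset_of_def using priestley_space_order(3)[OF prod] by blast
  ultimately have "(C, ?D) \<in> tensor_order Y r I"
    using P C by (intro tensor_closed_upset) auto
  moreover have "least_element ?r ?D = c"
    using \<open>c \<in> ?D\<close> by (intro least_element_eq[OF prod]) auto
  ultimately show thesis by (rule that)
qed

lemma tensor_orderD:
  assumes "(C, D) \<in> tensor_order Y r I"
  shows "C \<in> tensor Y r I" "D \<in> tensor Y r I" "D \<subseteq> C" "upset_of (product_order Y r I) C D"
  using assms by (auto simp: tensor_order_def CC_order_def upset_of_def)

text \<open>For an upset \<open>U\<close>, the least element of \<open>C\<close> has its
  \<open>i\<close>-th coordinate in \<open>U\<close> exactly when all of \<open>C\<close> does, so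
  the preimage of a clopen upset is the trace of a box.\<close>

lemma continuous_p_morphism_tensor_proj:
  assumes P: "\<And>i. i \<in> I \<Longrightarrow> priestley_space (Y i) (r i)" and i: "i \<in> I"
  shows "continuous_p_morphism (tensor_topology Y r I) (tensor_order Y r I) (Y i) (r i)
    (tensor_proj Y r I i)"
  unfolding continuous_p_morphism_def
proof (intro conjI ballI)
  let ?X = "product_topology Y I" and ?r = "product_order Y r I" and ?m = "least_element (product_order Y r I)"
  have m: "?m C \<in> C" "\<And>c. c \<in> C \<Longrightarrow> (?m C, c) \<in> ?r" if "C \<in> tensor Y r I" for C
    using tensor_least[of I Y r C, OF P that] by blast+
  have up: "upset_of (r i) (topspace (Y i)) ((\<lambda>x. x i) ` C)" if "C \<in> tensor Y r I" for C
    using that i by (simp add: tensor_def)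
  have sub: "C \<subseteq> topspace ?X" if "C \<in> tensor Y r I" for C
    using CC_subset_topspace[OF tensor_CC[OF that]] .
  show "continuous_map (tensor_topology Y r I) (Y i) (tensor_proj Y r I i)"
  proof (rule continuous_map_priestley[OF P[OF i]], unfold topspace_tensor)
    show "tensor_proj Y r I i C \<in> topspace (Y i)" if "C \<in> tensor Y r I" for C
      using m(1)[OF that] up[OF that] unfolding tensor_proj_def upset_of_def by blast
    fix U assume U: "clopenin (Y i) U" "upset_of (r i) (topspace (Y i)) U"
    let ?V = "{x \<in> topspace ?X. x i \<in> U}"
    have "clopenin ?X ?V"
      using continuous_map_product_projection[OF i, of Y] U(1) by (rule clopenin_continuous_preimage)
    then have "clopenin (CC_topology ?X ?r) {C \<in> CC ?X ?r. C \<subseteq> ?V}"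
      by (rule clopenin_CC_box)
    then have "clopenin (tensor_topology Y r I) (tensor Y r I \<inter> {C \<in> CC ?X ?r. C \<subseteq> ?V})"
      unfolding tensor_topology_def clopenin_def
      by (simp add: openin_subtopology_Int2 closedin_subtopology_Int_closed)
    moreover have "tensor_proj Y r I i C \<in> U \<longleftrightarrow> C \<in> CC ?X ?r \<and> C \<subseteq> ?V" if C: "C \<in> tensor Y r I" for C
    proof
      assume "tensor_proj Y r I i C \<in> U"
      then have "c i \<in> U" if "c \<in> C" for c
      proof -
        have "(?m C i, c i) \<in> r i" "c i \<in> topspace (Y i)"
          using m(2)[OF C that] i by (auto simp: product_order_def)
        then show ?thesis
          using U(2) \<open>tensor_proj Y r I i C \<in> U\<close> unfolding tensor_proj_def upset_of_def by blast
      qed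
      then show "C \<in> CC ?X ?r \<and> C \<subseteq> ?V"
        using sub[OF C] tensor_CC[OF C] by blast
    next
      assume "C \<in> CC ?X ?r \<and> C \<subseteq> ?V"
      then show "tensor_proj Y r I i C \<in> U"
        using m(1)[OF C] unfolding tensor_proj_def by blast
    qed
    then have "{C \<in> tensor Y r I. tensor_proj Y r I i C \<in> U} = tensor Y r I \<inter> {C \<in> CC ?X ?r. C \<subseteq> ?V}"
      by blast
    ultimately show "clopenin (tensor_topology Y r I) {C \<in> tensor Y r I. tensor_proj Y r I i C \<in> U}"
      by simp
  qed
  fix C assume "C \<in> topspace (tensor_topology Y r I)"
  then have C: "C \<in> tensor Y r I"
    by (simp add: topspace_tensor)
  show "tensor_proj Y r I i ` (tensor_order Y r I `` {C}) = r i `` {tensor_proj Y r I i C}"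
  proof (intro equalityI subsetI)
    fix y assume "y \<in> tensor_proj Y r I i ` (tensor_order Y r I `` {C})"
    then obtain D where D: "(C, D) \<in> tensor_order Y r I" "y = ?m D i"
      by (auto simp: tensor_proj_def)
    then have "?m D \<in> C"
      using m(1)[OF tensor_orderD(2)] tensor_orderD(3) by blast
    then have "(?m C, ?m D) \<in> ?r"
      by (rule m(2)[OF C])
    then show "y \<in> r i `` {tensor_proj Y r I i C}"
      using i D(2) by (simp add: product_order_def tensor_proj_def)
  next
    fix y assume "y \<in> r i `` {tensor_proj Y r I i C}"
    then have "(?m C i, y) \<in> r i" "y \<in> topspace (Y i)"
      using priestley_space_order(1)[OF P[OF i]] by (auto simp: tensor_proj_def)
    \<comment> \<open>Since the projection of \<open>C\<close> is an upset, \<open>y\<close> is a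
      coordinate of a point \<open>c\<close> of \<open>C\<close>; cutting \<open>C\<close> at
      \<open>c\<close> gives the required preimage of \<open>y\<close>.\<close>
    then obtain c where c: "c \<in> C" "y = c i"
      using up[OF C] m(1)[OF C] unfolding upset_of_def by blast
    then obtain D where "(C, D) \<in> tensor_order Y r I" "?m D = c"
      using tensor_principal_upset[of I Y r C c, OF P C] by blast
    then show "y \<in> tensor_proj Y r I i ` (tensor_order Y r I `` {C})"
      using c by (force simp: tensor_proj_def)
  qed
qed

section \<open>The lift of a cone and its uniqueness\<close>

locale tensor_cone =
  fixes I :: "'i set" and Y :: "'i \<Rightarrow> 'a topology" and r :: "'i \<Rightarrow> 'a rel"
    and Z :: "'z topology" and s :: "'z rel" and f :: "'i \<Rightarrow> 'z \<Rightarrow> 'a"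
  assumes EY: "\<And>i. i \<in> I \<Longrightarrow> esakia_root_system (Y i) (r i)"
    and EZ: "esakia_root_system Z s"
    and f: "\<And>i. i \<in> I \<Longrightarrow> continuous_p_morphism Z s (Y i) (r i) (f i)"
begin

abbreviation "X \<equiv> product_topology Y I"
abbreviation "R \<equiv> product_order Y r I"

definition F :: "'z \<Rightarrow> 'i \<Rightarrow> 'a" where
  "F z = (\<lambda>i\<in>I. f i z)"

text \<open>Restricting to \<open>topspace Z\<close> puts the map in the extensional normal form in
  which uniqueness is stated.\<close>

definition lift :: "'z \<Rightarrow> ('i \<Rightarrow> 'a) set" where
  "lift = (\<lambda>z\<in>topspace Z. F ` (s `` {z}))"

lemma priestley_Y: "i \<in> I \<Longrightarrow> priestley_space (Y i) (r i)"
  by (rule esakia_root_systemD(1)[OF EY])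

lemma priestley_X: "priestley_space X R"
  by (rule priestley_space_product[OF priestley_Y])

lemmas priestley_Z = esakia_root_systemD(1)[OF EZ]
lemmas Z_order = priestley_space_order[OF priestley_Z]

lemma cont_F: "continuous_map Z X F"
  unfolding continuous_map_componentwise
  using continuous_p_morphismD(1)[OF f] by (auto simp: F_def)

lemma F_topspace: "z \<in> topspace Z \<Longrightarrow> F z \<in> topspace X"
  using cont_F continuous_map_image_subset_topspace by blast

lemma F_mono:
  assumes "(z, w) \<in> s"
  shows "(F z, F w) \<in> R"
proof -
  have "z \<in> topspace Z" "w \<in> topspace Z"
    using assms Z_order(1) by blast+
  moreover have "\<forall>i\<in>I. (F z i, F w i) \<in> r i"
    using continuous_p_morphismD(3)[OF f _ assms] \<open>z \<in> topspace Z\<close> by (simp add: F_def)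
  ultimately show ?thesis
    using F_topspace by (simp add: product_order_def)
qed

lemma closedin_up: "z \<in> topspace Z \<Longrightarrow> closedin Z (s `` {z})"
  by (intro closedin_priestley_upset[OF priestley_Z] closedin_priestley_sing[OF priestley_Z])

text \<open>\<open>F\<close> is monotone and, as a continuous map from a compact to a Hausdorff
  space, closed, so it takes the closed chain above \<open>z\<close> to a closed chain. The
  \<open>i\<close>-th projection of the image is the principal upset of \<open>f i z\<close>,
  because \<open>f i\<close> is a p-morphism.\<close>

lemma lift_tensor:
  assumes z: "z \<in> topspace Z"
  shows "lift z \<in> tensor Y r I"
proof -
  have lift: "lift z = F ` (s `` {z})"
    using z by (simp add: lift_def)
  have "closed_map Z X F"
    by (rule continuous_imp_closed_map[OF cont_F priestley_space_compact[OF priestley_Z] priestley_space_Hausdorff[OF priestley_X]])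
  then have "closedin X (lift z)"
    using closedin_up[OF z] by (simp add: lift closed_map_def)
  moreover have "lift z \<noteq> {}"
    using Z_order(2)[OF z] by (auto simp: lift)
  moreover have "lift z \<in> Chains R"
    unfolding lift Chains_def using esakia_root_systemD(3)[OF EZ, of z] F_mono by blast
  moreover have "upset_of (r i) (topspace (Y i)) ((\<lambda>x. x i) ` lift z)" if i: "i \<in> I" for i
  proof -
    have "(\<lambda>x. x i) ` lift z = r i `` {f i z}"
      using i continuous_p_morphismD(2)[OF f[OF i] z] by (simp add: lift image_image F_def)
    then show ?thesis
      using priestley_space_order(1,3)[OF priestley_Y[OF i]] unfolding upset_of_def by auto
  qed
  ultimately show ?thesis
    by (simp add: tensor_def CC_def)
qed

text \<open>Monotonicity of \<open>F\<close> makes \<open>F z\<close> least; read coordinatewise,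
  this says that the lift commutes with the projections.\<close>

lemma least_lift:
  assumes z: "z \<in> topspace Z"
  shows "least_element R (lift z) = F z"
proof (rule least_element_eq[OF priestley_X])
  show "F z \<in> lift z"
    using Z_order(2)[OF z] z by (simp add: lift_def)
  show "(F z, y) \<in> R" if "y \<in> lift z" for y
    using that z F_mono by (auto simp: lift_def)
qed

text \<open>The preimage of a diamond is the downset of a clopen preimage under \<open>F\<close>,
  and that of a box is the complement of the downset of the complementary preimage. Both are clopen
  because \<open>Z\<close> is Esakia.\<close>

lemma continuous_map_lift: "continuous_map Z (tensor_topology Y r I) lift"
  unfolding tensor_topology_def
proof (rule continuous_map_into_subtopology)
  have lift_CC: "lift z \<in> CC X R" if "z \<in> topspace Z" for z
    by (rule tensor_CC[OF lift_tensor[OF that]])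
  show "continuous_map Z (CC_topology X R) lift"
    unfolding CC_topology_def
  proof (rule continuous_on_generated_topo)
    fix \<U> assume "\<U> \<in> {{C \<in> CC X R. C \<subseteq> V} | V. clopenin X V} \<union> {{C \<in> CC X R. C \<inter> V \<noteq> {}} | V. clopenin X V}"
    then consider V where "clopenin X V" "\<U> = {C \<in> CC X R. C \<subseteq> V}"
      | V where "clopenin X V" "\<U> = {C \<in> CC X R. C \<inter> V \<noteq> {}}"
      by blast
    then show "openin Z (lift -` \<U> \<inter> topspace Z)"
    proof cases
      case 1
      let ?W = "{z \<in> topspace Z. F z \<in> V}"
      have W: "clopenin Z (topspace Z - s\<inverse> `` (topspace Z - ?W))"
        by (intro clopenin_compl esakia_root_systemD(2)[OF EZ] clopenin_continuous_preimage[OF cont_F] 1)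
      have "lift z \<in> \<U> \<longleftrightarrow> z \<notin> s\<inverse> `` (topspace Z - ?W)" if z: "z \<in> topspace Z" for z
      proof -
        have "lift z \<in> \<U> \<longleftrightarrow> F ` (s `` {z}) \<subseteq> V"
          using lift_CC[OF z] z 1(2) by (simp add: lift_def)
        also have "\<dots> \<longleftrightarrow> z \<notin> s\<inverse> `` (topspace Z - ?W)"
          using Z_order(1) by blast
        finally show ?thesis .
      qed
      then have "lift -` \<U> \<inter> topspace Z = topspace Z - s\<inverse> `` (topspace Z - ?W)"
        by blast
      then show ?thesis
        using W by (simp add: clopenin_def)
    next
      case 2
      let ?W = "{z \<in> topspace Z. F z \<in> V}"
      have W: "clopenin Z (s\<inverse> `` ?W)"
        by (intro esakia_root_systemD(2)[OF EZ] clopenin_continuous_preimage[OF cont_F] 2)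
      have "lift z \<in> \<U> \<longleftrightarrow> z \<in> s\<inverse> `` ?W" if z: "z \<in> topspace Z" for z
      proof -
        have "lift z \<in> \<U> \<longleftrightarrow> F ` (s `` {z}) \<inter> V \<noteq> {}"
          using lift_CC[OF z] z 2(2) by (simp add: lift_def)
        also have "\<dots> \<longleftrightarrow> z \<in> s\<inverse> `` ?W"
          using Z_order(1) by blast
        finally show ?thesis .
      qed
      then have "lift -` \<U> \<inter> topspace Z = s\<inverse> `` ?W"
        using clopenin_subset[OF W] by blast
      then show ?thesis
        using W by (simp add: clopenin_def)
    qed
  next
    have "lift ` topspace Z \<subseteq> topspace (CC_topology X R)"
      using lift_CC by (auto simp: topspace_CC)
    then show "lift ` topspace Z \<subseteq> \<Union> ({{C \<in> CC X R. C \<subseteq> V} | V. clopenin X V} \<union> {{C \<in> CC X R. C \<inter> V \<noteq> {}} | V. clopenin X V})"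
      unfolding CC_topology_def topology_generated_by_topspace .
  qed
  show "lift \<in> topspace Z \<rightarrow> tensor Y r I"
    using lift_tensor by blast
qed

text \<open>The forth direction checks that the image of the points above \<open>w\<close> is an
  upset in the image of those above \<open>z\<close>. For the back direction, a closed upset
  \<open>D\<close> of \<open>lift z\<close> is pulled back to a closed chain of \<open>Z\<close>,
  whose least element is the point sought.\<close>

lemma continuous_p_morphism_lift:
  "continuous_p_morphism Z s (tensor_topology Y r I) (tensor_order Y r I) lift"
  unfolding continuous_p_morphism_def
proof (intro conjI ballI continuous_map_lift equalityI subsetI)
  fix z assume z: "z \<in> topspace Z"
  then have lift_z: "lift z = F ` (s `` {z})"
    by (simp add: lift_def)
  {
    fix D assume "D \<in> lift ` (s `` {z})"
    then obtain w where w: "(z, w) \<in> s" "D = lift w"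
      by blast
    then have w_top: "w \<in> topspace Z"
      using Z_order(1) by blast
    then have D: "D = F ` (s `` {w})"
      using w(2) by (simp add: lift_def)
    have D_tensor: "D \<in> CC X R"
      using tensor_CC[OF lift_tensor[OF w_top]] w(2) by simp
    have "upset_of R (lift z) D"
      unfolding upset_of_def
    proof (intro conjI ballI impI)
      show "D \<subseteq> lift z"
        using w(1) Z_order(3) unfolding D lift_z by blast
      fix a b assume "a \<in> D" "b \<in> lift z" "(a, b) \<in> R"
      then obtain u v where u: "(w, u) \<in> s" "a = F u" and v: "(z, v) \<in> s" "b = F v"
        unfolding D lift_z by blast
      consider "(w, v) \<in> s" | "(v, w) \<in> s"
        using esakia_root_systemD(3)[OF EZ w(1) v(1)] by blast
      then show "b \<in> D"
      proof cases
        case 1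
        then show ?thesis using v unfolding D by blast
      next
        case 2
        \<comment> \<open>Here \<open>v\<close> is below \<open>w\<close>, which is below
          \<open>u\<close>, so \<open>b = F v\<close> is below \<open>a = F u\<close>; with the
          assumed reverse inequality the two coincide.\<close>
        then have "(v, u) \<in> s"
          using u(1) Z_order(3) by blast
        then have "a = b"
          using F_mono priestley_space_order(4)[OF priestley_X] u(2) v(2) \<open>(a, b) \<in> R\<close> by blast
        then show ?thesis using \<open>a \<in> D\<close> by simp
      qed
    qed
    then show "D \<in> tensor_order Y r I `` {lift z}"
      using D_tensor tensor_closed_upset[OF priestley_Y lift_tensor[OF z], of D] by (simp add: CC_def)
  }
  fix D assume "D \<in> tensor_order Y r I `` {lift z}"
  then have D: "closedin X D" "D \<noteq> {}" "D \<subseteq> lift z" "upset_of R (lift z) D"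
    using tensor_CC[OF tensor_orderD(2), of "lift z" D] tensor_orderD(3,4)[of "lift z" D]
    by (auto simp: CC_def)
  let ?T = "s `` {z} \<inter> {w \<in> topspace Z. F w \<in> D}"
  have "F ` ?T = D"
    using D(3) Z_order(1) unfolding lift_z by blast
  have "?T \<in> CC Z s"
    unfolding CC_def
  proof (intro CollectI conjI)
    show "?T \<noteq> {}"
      using D(2) \<open>F ` ?T = D\<close> by blast
    show "closedin Z ?T"
      by (intro closedin_Int closedin_up z closedin_continuous_map_preimage[OF cont_F D(1)])
    show "?T \<in> Chains s"
      unfolding Chains_def using esakia_root_systemD(3)[OF EZ, of z] by blast
  qed
  then obtain w where w: "w \<in> ?T" "\<And>v. v \<in> ?T \<Longrightarrow> (w, v) \<in> s"
    using priestley_chain_least[OF priestley_Z] by blast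
  \<comment> \<open>A point \<open>v\<close> above \<open>w\<close> has \<open>F v\<close> in
    \<open>lift z\<close> and above \<open>F w\<close>, which is in \<open>D\<close>; as
    \<open>D\<close> is an upset of \<open>lift z\<close>, \<open>v\<close> belongs to the
    pullback.\<close>
  have "?T = s `` {w}"
  proof (intro equalityI subsetI)
    fix v assume "v \<in> s `` {w}"
    then have v: "(w, v) \<in> s" "(z, v) \<in> s" "v \<in> topspace Z"
      using w(1) Z_order(1,3) by blast+
    then have "F v \<in> lift z" "(F w, F v) \<in> R" "F w \<in> D"
      using w(1) F_mono unfolding lift_z by blast+
    then show "v \<in> ?T"
      using D(4) v unfolding upset_of_def by blast
  qed (use w(2) in blast)
  moreover have "w \<in> topspace Z"
    using w(1) by blast
  ultimately have "D = lift w"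
    using \<open>F ` ?T = D\<close> by (simp add: lift_def)
  then show "D \<in> lift ` (s `` {z})"
    using w(1) by blast
qed

lemma lift_unique:
  assumes h: "continuous_p_morphism Z s (tensor_topology Y r I) (tensor_order Y r I) h"
    and ext: "h \<in> extensional (topspace Z)"
    and proj: "\<And>i z. i \<in> I \<Longrightarrow> z \<in> topspace Z \<Longrightarrow> tensor_proj Y r I i (h z) = f i z"
  shows "h = lift"
proof (rule extensionalityI[OF ext])
  show "lift \<in> extensional (topspace Z)"
    by (simp add: lift_def)
  have tensor: "h z \<in> tensor Y r I" if "z \<in> topspace Z" for z
    using continuous_p_morphismD(1)[OF h] that topspace_tensor[of Y r I]
      continuous_map_image_subset_topspace by blast
  \<comment> \<open>The projections prescribe this element on \<open>I\<close> only; extensionality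
    of points of the product fixes the rest.\<close>
  have least: "least_element R (h z) = F z" if z: "z \<in> topspace Z" for z
  proof (rule extensionalityI[of _ I])
    have "least_element R (h z) \<in> topspace X"
      using tensor_least(1)[OF priestley_Y tensor[OF z]] CC_subset_topspace[OF tensor_CC[OF tensor[OF z]]]
      by blast
    then show "least_element R (h z) \<in> extensional I"
      by (simp add: PiE_def)
    show "F z \<in> extensional I"
      by (simp add: F_def)
    show "least_element R (h z) i = F z i" if "i \<in> I" for i
      using proj[OF that z] that by (simp add: F_def tensor_proj_def)
  qed
  fix z assume z: "z \<in> topspace Z"
  show "h z = lift z"
  proof (intro equalityI subsetI)
    fix c assume "c \<in> h z"
    then obtain D where D: "(h z, D) \<in> tensor_order Y r I" "least_element R D = c"
      using tensor_principal_upset[OF priestley_Y tensor[OF z]] by blast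
    \<comment> \<open>The back condition for \<open>h\<close> presents \<open>D\<close> as
      \<open>h w\<close> with \<open>w\<close> above \<open>z\<close>, so its least element
      \<open>c\<close> is \<open>F w\<close>.\<close>
    then have "D \<in> h ` (s `` {z})"
      by (simp add: continuous_p_morphismD(2)[OF h z])
    then obtain w where w: "(z, w) \<in> s" "least_element R (h w) = c"
      using D(2) by blast
    then have "c = F w"
      using least Z_order(1) by blast
    then show "c \<in> lift z"
      using w(1) z by (simp add: lift_def)
  next
    fix c assume "c \<in> lift z"
    then obtain w where w: "(z, w) \<in> s" "c = F w"
      using z by (auto simp: lift_def)
    then have w_top: "w \<in> topspace Z"
      using Z_order(1) by blast
    have "h w \<subseteq> h z"
      using continuous_p_morphismD(3)[OF h z w(1)] by (rule tensor_orderD(3))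
    then show "c \<in> h z"
      using tensor_least(1)[OF priestley_Y tensor[OF w_top]] least[OF w_top] w(2) by auto
  qed
qed

end

text \<open>A map on the carrier of \<open>Z\<close> is represented by its extensional function, so
  \<open>\<exists>!\<close> expresses uniqueness of the morphism and ignores values outside the
  carrier.\<close>

theorem theorem4p7:
  fixes I :: "'i set"
    and Y :: "'i \<Rightarrow> 'a topology"
    and r :: "'i \<Rightarrow> 'a rel"
  assumes "\<forall>i\<in>I. esakia_root_system (Y i) (r i)"
  shows "esakia_root_system (tensor_topology Y r I) (tensor_order Y r I) \<and>
    (\<forall>i\<in>I. continuous_p_morphism (tensor_topology Y r I) (tensor_order Y r I) (Y i) (r i)
              (tensor_proj Y r I i)) \<and>
    (\<forall>(Z :: 'z topology) s f.
       esakia_root_system Z s \<and> (\<forall>i\<in>I. continuous_p_morphism Z s (Y i) (r i) (f i)) \<longrightarrow>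
       (\<exists>!h. h \<in> extensional (topspace Z) \<and>
          continuous_p_morphism Z s (tensor_topology Y r I) (tensor_order Y r I) h \<and>
          (\<forall>i\<in>I. \<forall>z\<in>topspace Z. tensor_proj Y r I i (h z) = f i z)))"
proof (intro conjI ballI allI impI)
  show "esakia_root_system (tensor_topology Y r I) (tensor_order Y r I)"
    using assms by (intro esakia_root_system_tensor) blast
  show "continuous_p_morphism (tensor_topology Y r I) (tensor_order Y r I) (Y i) (r i)
      (tensor_proj Y r I i)" if "i \<in> I" for i
    using assms that by (intro continuous_p_morphism_tensor_proj esakia_root_systemD(1)) blast+
  fix Z :: "'z topology" and s f
  assume "esakia_root_system Z s \<and> (\<forall>i\<in>I. continuous_p_morphism Z s (Y i) (r i) (f i))"
  then interpret tensor_cone I Y r Z s f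
    using assms by unfold_locales blast+
  show "\<exists>!h. h \<in> extensional (topspace Z) \<and>
      continuous_p_morphism Z s (tensor_topology Y r I) (tensor_order Y r I) h \<and>
      (\<forall>i\<in>I. \<forall>z\<in>topspace Z. tensor_proj Y r I i (h z) = f i z)"
  proof (rule ex1I[of _ lift])
    show "lift \<in> extensional (topspace Z) \<and>
        continuous_p_morphism Z s (tensor_topology Y r I) (tensor_order Y r I) lift \<and>
        (\<forall>i\<in>I. \<forall>z\<in>topspace Z. tensor_proj Y r I i (lift z) = f i z)"
      using continuous_p_morphism_lift least_lift by (simp add: lift_def tensor_proj_def F_def)
  qed (use lift_unique in blast)
qed

end
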